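(* Let $G$ be a compact group with normalized Haar measure $\mu$, let $\pi:G\to U(\mathcal H)$ be a unitary representation on a finite-dimensional complex Hilbert space $\mathcal H$, and suppose that for some unitary $U$ $$U\pi(g)U^*=\bigoplus_{\alpha=1}^{s}\bigl(I_{m_\alpha}\otimes\pi_\alpha(g)\bigr),\qquad g\in G,$$ where $\pi_1,\dots,\pi_s$ are pairwise inequivalent irreducible unitary representations of $G$ and $m_\alpha\ge 1$ is the multiplicity of $\pi_\alpha$. Let $\Phi_\pi(\rho)=\int_G\pi(g)\rho\,\pi(g^{-1})\,d\mu(g)$ be the twirling channel associated with $\pi$. Then $$\dim S_{\Phi_\pi^{c}}=\sum_{\alpha=1}^{s}m_\alpha^{2}.$$
   Context: Representations are continuous. The twirling channel $\Phi_\pi:B(\mathcal H)\to B(\mathcal H)$ is a completely positive trace preserving map, so it has a Kraus representation $\Phi_\pi(\rho)=\sum_{i=1}^{r}A_i\rho A_i^*$ with finitely many $A_i\in B(\mathcal H)$; fix any such representation. The complementary channel associated with $\{A_i\}_{i=1}^r$ is $\Phi_\pi^{c}(\rho)=\sum_{i,j=1}^{r}\operatorname{Tr}(A_i\rho A_j^* )|i\rangle\langle j|$ on $B(\mathbb C^r)$, with $\{|i\rangle\}$ the standard basis of $\mathbb C^r$. Fixing an orthonormal basis $\{|a\rangle\}_{a=1}^{\dim\mathcal H}$ of the output space $\mathcal H$, the canonical Kraus operators of $\Phi_\pi^{c}$ are $R_a=\sum_{i=1}^{r}|i\rangle\langle a|A_i$, and the associated operator system is $S_{\Phi_\pi^{c}}=\operatorname{span}\{R_b^*R_a:1\le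 a,b\le\dim\mathcal H\}\subset B(\mathcal H)$ (complex span and complex dimension). *)

theory Defs
  imports
    "HOL-Probability.Probability_Measure"
    "HOL-Algebra.Coset"
    "Jordan_Normal_Form.Schur_Decomposition"
    "Jordan_Normal_Form.VS_Connect"
begin

hide_const (open) Finite_Cartesian_Product.vec Finite_Cartesian_Product.mat

unbundle no vec_syntax

text \<open>
  Throughout, an \<open>n\<close>-dimensional complex Hilbert space is \<open>carrier_vec n\<close> over the complex
  numbers with the inner product \<open>v \<bullet>c w\<close> (linear in the first, conjugate-linear in the second
  argument), and operators on it are matrices in \<open>carrier_mat n n\<close>.
\<close>

subsection \<open>Compact groups and Haar measure\<close>

definition compact_group :: "'g monoid \<Rightarrow> 'g topology \<Rightarrow> bool" where
  "compact_group G T \<longleftrightarrow>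
     group G \<and> topspace T = carrier G \<and>
     continuous_map (prod_topology T T) T (\<lambda>(x, y). x \<otimes>\<^bsub>G\<^esub> y) \<and>
     continuous_map T T (\<lambda>x. inv\<^bsub>G\<^esub> x) \<and>
     compact_space T \<and> Hausdorff_space T"

definition normalized_haar_measure :: "'g monoid \<Rightarrow> 'g topology \<Rightarrow> 'g measure \<Rightarrow> bool" where
  "normalized_haar_measure G T M \<longleftrightarrow>
     prob_space M \<and> space M = carrier G \<and>
     sets M = sigma_sets (carrier G) {V. openin T V} \<and>
     (\<forall>g \<in> carrier G. \<forall>B \<in> sets M. emeasure M (g <#\<^bsub>G\<^esub> B) = emeasure M B) \<and>
     (\<forall>B \<in> sets M. emeasure M B = (INF V \<in> {V. openin T V \<and> B \<subseteq> V}. emeasure M V)) \<and>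
     (\<forall>V. openin T V \<longrightarrow> emeasure M V = (SUP K \<in> {K. compactin T K \<and> K \<subseteq> V}. emeasure M K))"

subsection \<open>Matrices\<close>

definition unitary_mat :: "nat \<Rightarrow> complex mat \<Rightarrow> bool" where
  "unitary_mat n U \<longleftrightarrow>
     U \<in> carrier_mat n n \<and> U * mat_adjoint U = 1\<^sub>m n \<and> mat_adjoint U * U = 1\<^sub>m n"

definition mat_trace :: "complex mat \<Rightarrow> complex" where
  "mat_trace X = (\<Sum>k<dim_row X. X $$ (k, k))"

definition kronecker :: "complex mat \<Rightarrow> complex mat \<Rightarrow> complex mat" where
  "kronecker X Y =
     mat (dim_row X * dim_row Y) (dim_col X * dim_col Y)
       (\<lambda>(i, j). X $$ (i div dim_row Y, j div dim_col Y) * Y $$ (i mod dim_row Y, j mod dim_col Y))"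

text \<open>The rank-one operator \<open>|v\<rangle>\<langle>w|\<close>.\<close>

definition ketbra :: "complex vec \<Rightarrow> complex vec \<Rightarrow> complex mat" where
  "ketbra v w = mat (dim_vec v) (dim_vec w) (\<lambda>(i, j). v $ i * cnj (w $ j))"

text \<open>\<open>n\<close> orthonormal vectors in an \<open>n\<close>-dimensional space automatically form a basis.\<close>

definition orthonormal_basis :: "nat \<Rightarrow> (nat \<Rightarrow> complex vec) \<Rightarrow> bool" where
  "orthonormal_basis n e \<longleftrightarrow>
     (\<forall>a<n. e a \<in> carrier_vec n) \<and>
     (\<forall>a<n. \<forall>b<n. e a \<bullet>c e b = (if a = b then 1 else 0))"

subsection \<open>Unitary representations\<close>

text \<open>
  Continuity is stated for the matrix entries, which in finite dimension is continuity in norm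
  (equivalently, strong continuity).
\<close>

definition unitary_rep :: "'g monoid \<Rightarrow> 'g topology \<Rightarrow> nat \<Rightarrow> ('g \<Rightarrow> complex mat) \<Rightarrow> bool" where
  "unitary_rep G T n \<pi> \<longleftrightarrow>
     (\<forall>g \<in> carrier G. unitary_mat n (\<pi> g)) \<and>
     (\<forall>g \<in> carrier G. \<forall>h \<in> carrier G. \<pi> (g \<otimes>\<^bsub>G\<^esub> h) = \<pi> g * \<pi> h) \<and>
     (\<forall>i<n. \<forall>j<n. continuous_map T euclidean (\<lambda>g. \<pi> g $$ (i, j)))"

definition irreducible_rep :: "'g monoid \<Rightarrow> nat \<Rightarrow> ('g \<Rightarrow> complex mat) \<Rightarrow> bool" where
  "irreducible_rep G n \<pi> \<longleftrightarrow>
     n > 0 \<and>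
     (\<forall>W. VectorSpace.subspace class_ring W (module_vec TYPE(complex) n) \<longrightarrow>
          (\<forall>g \<in> carrier G. \<forall>w \<in> W. \<pi> g *\<^sub>v w \<in> W) \<longrightarrow>
          W = {0\<^sub>v n} \<or> W = carrier_vec n)"

definition equivalent_reps ::
    "'g monoid \<Rightarrow> nat \<Rightarrow> ('g \<Rightarrow> complex mat) \<Rightarrow> nat \<Rightarrow> ('g \<Rightarrow> complex mat) \<Rightarrow> bool" where
  "equivalent_reps G n \<pi> k \<sigma> \<longleftrightarrow>
     (\<exists>X \<in> carrier_mat k n. invertible_mat X \<and> (\<forall>g \<in> carrier G. X * \<pi> g = \<sigma> g * X))"

subsection \<open>Channels\<close>

text \<open>
  \<open>kraus_rep n k N A \<Phi>\<close>: the map \<open>\<Phi>\<close> from operators on \<open>\<complex>\<^sup>n\<close> to operators on \<open>\<complex>\<^sup>k\<close> is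
  \<open>\<rho> \<mapsto> \<Sum>\<^sub>i A\<^sub>i \<rho> A\<^sub>i\<^sup>*\<close>, with \<open>i\<close> ranging over \<open>{..<N}\<close>.
\<close>

definition kraus_rep ::
    "nat \<Rightarrow> nat \<Rightarrow> nat \<Rightarrow> (nat \<Rightarrow> complex mat) \<Rightarrow> (complex mat \<Rightarrow> complex mat) \<Rightarrow> bool" where
  "kraus_rep n k N A \<Phi> \<longleftrightarrow>
     (\<forall>i<N. A i \<in> carrier_mat k n) \<and>
     (\<forall>\<rho> \<in> carrier_mat n n.
        \<Phi> \<rho> = (\<Oplus>\<^bsub>module_mat TYPE(complex) k k\<^esub> i \<in> {..<N}. A i * \<rho> * mat_adjoint (A i)))"

text \<open>The matrix-valued integral is taken entrywise.\<close>

definition twirl ::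
    "'g monoid \<Rightarrow> 'g measure \<Rightarrow> nat \<Rightarrow> ('g \<Rightarrow> complex mat) \<Rightarrow> complex mat \<Rightarrow> complex mat" where
  "twirl G M n \<pi> \<rho> =
     mat n n (\<lambda>(i, j). \<integral>g. (\<pi> g * \<rho> * \<pi> (inv\<^bsub>G\<^esub> g)) $$ (i, j) \<partial>M)"

definition complementary_channel ::
    "nat \<Rightarrow> (nat \<Rightarrow> complex mat) \<Rightarrow> complex mat \<Rightarrow> complex mat" where
  "complementary_channel r A \<rho> =
     mat r r (\<lambda>(i, j). mat_trace (A i * \<rho> * mat_adjoint (A j)))"

definition canonical_kraus ::
    "nat \<Rightarrow> nat \<Rightarrow> (nat \<Rightarrow> complex mat) \<Rightarrow> (nat \<Rightarrow> complex vec) \<Rightarrow> nat \<Rightarrow> complex mat" where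
  "canonical_kraus n r A e a =
     (\<Oplus>\<^bsub>module_mat TYPE(complex) r n\<^esub> i \<in> {..<r}. ketbra (unit_vec r i) (e a) * A i)"

text \<open>The operator system on \<open>\<complex>\<^sup>n\<close> of a channel with Kraus operators \<open>R\<^sub>0, \<dots>, R\<^sub>N\<^sub>-\<^sub>1\<close>.\<close>

definition operator_system :: "nat \<Rightarrow> nat \<Rightarrow> (nat \<Rightarrow> complex mat) \<Rightarrow> complex mat set" where
  "operator_system n N R =
     LinearCombinations.module.span class_ring (module_mat TYPE(complex) n n)
       {mat_adjoint (R b) * R a | a b. a < N \<and> b < N}"

text \<open>The complex dimension of a linear subspace of the \<open>n \<times> n\<close> matrices.\<close>

definition mat_subspace_dim :: "nat \<Rightarrow> complex mat set \<Rightarrow> nat" where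
  "mat_subspace_dim n S =
     vectorspace.dim class_ring ((module_mat TYPE(complex) n n)\<lparr>carrier := S\<rparr>)"

subsection \<open>The canonical operators are Kraus operators of the complementary channel\<close>

lemma finsum_mat_carrier_index:
  assumes "finite I" "\<And>i. i \<in> I \<Longrightarrow> f i \<in> carrier_mat p q"
  shows "finsum (module_mat TYPE(complex) p q) f I \<in> carrier_mat p q \<and>
    (\<forall>k<p. \<forall>l<q. finsum (module_mat TYPE(complex) p q) f I $$ (k, l) = (\<Sum>i\<in>I. f i $$ (k, l)))"
proof -
  interpret V: abelian_group "module_mat TYPE(complex) p q" by (rule abelian_group_mat)
  show ?thesis using assms
  proof (induction I rule: finite_induct)
    case empty
    then show ?case by (simp add: V.finsum_empty module_mat_simps)
  next
    case (insert x I)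
    have "finsum (module_mat TYPE(complex) p q) f (insert x I)
        = f x + finsum (module_mat TYPE(complex) p q) f I"
      using insert by (subst V.finsum_insert) (auto simp: module_mat_simps)
    with insert show ?case by auto
  qed
qed

lemma mat_adjoint_index:
  fixes X :: "complex mat"
  shows "dim_row (mat_adjoint X) = dim_col X" "dim_col (mat_adjoint X) = dim_row X"
    "\<And>i j. i < dim_col X \<Longrightarrow> j < dim_row X \<Longrightarrow> mat_adjoint X $$ (i, j) = cnj (X $$ (j, i))"
  by (auto simp: mat_adjoint_def mat_of_rows_def)

lemma orthonormal_basis_resolution:
  assumes "orthonormal_basis n e" "k < n" "l < n"
  shows "(\<Sum>a<n. cnj (e a $ k) * e a $ l) = (if k = l then 1 else 0)"
proof -
  define E where "E = mat n n (\<lambda>(i, a). e a $ i)"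
  define F where "F = mat n n (\<lambda>(a, i). cnj (e a $ i))"
  have E: "E \<in> carrier_mat n n" and F: "F \<in> carrier_mat n n"
    by (auto simp: E_def F_def)
  have e: "dim_vec (e a) = n" if "a < n" for a
    using assms(1) that by (auto simp: orthonormal_basis_def)
  have "F * E = 1\<^sub>m n"
  proof (rule eq_matI)
    fix a b assume "a < dim_row (1\<^sub>m n :: complex mat)" "b < dim_col (1\<^sub>m n :: complex mat)"
    then have ab: "a < n" "b < n" by auto
    have "(F * E) $$ (a, b) = (\<Sum>i<n. cnj (e a $ i) * e b $ i)"
      using ab by (simp add: E_def F_def scalar_prod_def lessThan_atLeast0)
    also have "\<dots> = e b \<bullet>c e a"
      using ab by (simp add: scalar_prod_def e lessThan_atLeast0 mult.commute)
    also have "\<dots> = (1\<^sub>m n) $$ (a, b)"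
      using assms(1) ab by (auto simp: orthonormal_basis_def)
    finally show "(F * E) $$ (a, b) = (1\<^sub>m n) $$ (a, b)" .
  qed (auto simp: E_def F_def)
  then have "E * F = 1\<^sub>m n"
    using mat_mult_left_right_inverse[OF F E] by simp
  moreover have "(E * F) $$ (l, k) = (\<Sum>a<n. cnj (e a $ k) * e a $ l)"
    using assms(2,3) by (simp add: E_def F_def scalar_prod_def lessThan_atLeast0 mult.commute)
  ultimately show ?thesis
    using assms(2,3) by auto
qed

lemma canonical_kraus_carrier_index:
  assumes "\<forall>i<r. A i \<in> carrier_mat n n" "e a \<in> carrier_vec n"
  shows "canonical_kraus n r A e a \<in> carrier_mat r n"
    and "\<And>i l. i < r \<Longrightarrow> l < n \<Longrightarrow>
      canonical_kraus n r A e a $$ (i, l) = (\<Sum>k<n. cnj (e a $ k) * A i $$ (k, l))"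
proof -
  define f where "f i = ketbra (unit_vec r i) (e a) * A i" for i
  have f: "f i \<in> carrier_mat r n" if "i < r" for i
    using assms that unfolding f_def ketbra_def
    by (intro mult_carrier_mat[of _ r n]) (auto simp: carrier_vecD)
  have f_index: "f i $$ (j, l) = (if j = i then \<Sum>k<n. cnj (e a $ k) * A i $$ (k, l) else 0)"
    if "i < r" "j < r" "l < n" for i j l
  proof -
    have "A i \<in> carrier_mat n n" using assms(1) that by simp
    then show ?thesis
      using assms(2) that
      by (auto simp: f_def ketbra_def scalar_prod_def lessThan_atLeast0)
  qed
  note fin = finsum_mat_carrier_index[of "{..<r}" f r n]
  have eq: "canonical_kraus n r A e a = finsum (module_mat TYPE(complex) r n) f {..<r}"
    by (simp add: canonical_kraus_def f_def[abs_def])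
  show "canonical_kraus n r A e a \<in> carrier_mat r n"
    using fin f by (simp add: eq)
  fix i l assume il: "i < r" "l < n"
  have "canonical_kraus n r A e a $$ (i, l) = (\<Sum>j<r. f j $$ (i, l))"
    using fin f il by (simp add: eq)
  also have "\<dots> = (\<Sum>j<r. if i = j then \<Sum>k<n. cnj (e a $ k) * A j $$ (k, l) else 0)"
    by (intro sum.cong) (use il in \<open>auto simp: f_index\<close>)
  also have "\<dots> = (\<Sum>k<n. cnj (e a $ k) * A i $$ (k, l))"
    using il by simp
  finally show "canonical_kraus n r A e a $$ (i, l) = (\<Sum>k<n. cnj (e a $ k) * A i $$ (k, l))" .
qed

lemma sandwich_index:
  fixes X Y \<rho> :: "complex mat"
  assumes "X \<in> carrier_mat p n" "\<rho> \<in> carrier_mat n n" "Y \<in> carrier_mat q n" "i < p" "j < q"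
  shows "(X * \<rho> * mat_adjoint Y) $$ (i, j)
    = (\<Sum>l<n. \<Sum>l'<n. X $$ (i, l') * \<rho> $$ (l', l) * cnj (Y $$ (j, l)))"
  using assms
  by (auto simp: scalar_prod_def lessThan_atLeast0 mat_adjoint_index sum_distrib_right
      intro!: sum.cong)

lemma kraus_rep_complementary_channel:
  assumes A: "\<forall>i<r. A i \<in> carrier_mat n n" and e: "orthonormal_basis n e"
  shows "kraus_rep n r n (canonical_kraus n r A e) (complementary_channel r A)"
  unfolding kraus_rep_def
proof (intro conjI allI impI ballI)
  let ?R = "canonical_kraus n r A e"
  have ea: "e a \<in> carrier_vec n" if "a < n" for a
    using e that by (simp add: orthonormal_basis_def)
  have R: "?R a \<in> carrier_mat r n" if "a < n" for a
    using canonical_kraus_carrier_index(1)[where e = e, OF A ea[OF that]] .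
  have R_index: "?R a $$ (i, l) = (\<Sum>k<n. cnj (e a $ k) * A i $$ (k, l))"
    if "a < n" "i < r" "l < n" for a i l
    using canonical_kraus_carrier_index(2)[where e = e, OF A ea[OF that(1)] that(2,3)] .
  show "?R a \<in> carrier_mat r n" if "a < n" for a
    using R[OF that] .
  fix \<rho> :: "complex mat" assume \<rho>: "\<rho> \<in> carrier_mat n n"
  define f where "f a = ?R a * \<rho> * mat_adjoint (?R a)" for a
  have f: "f a \<in> carrier_mat r r" if "a < n" for a
    using R[OF that] by (intro carrier_matI) (auto simp: f_def mat_adjoint_index)
  note fin = finsum_mat_carrier_index[of "{..<n}" f r r]
  have "complementary_channel r A \<rho> = finsum (module_mat TYPE(complex) r r) f {..<n}"
  proof (rule eq_matI)
    fix i j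
    assume "i < dim_row (finsum (module_mat TYPE(complex) r r) f {..<n})"
      and "j < dim_col (finsum (module_mat TYPE(complex) r r) f {..<n})"
    then have ij: "i < r" "j < r" using fin f by auto
    have Ai: "A i \<in> carrier_mat n n" and Aj: "A j \<in> carrier_mat n n"
      using A ij by auto
    define X where "X = A i * \<rho> * mat_adjoint (A j)"
    have X: "X $$ (k, k') = (\<Sum>l<n. \<Sum>l'<n. A i $$ (k, l') * \<rho> $$ (l', l) * cnj (A j $$ (k', l)))"
      if "k < n" "k' < n" for k k'
      unfolding X_def by (rule sandwich_index) (use Ai Aj \<rho> that in auto)
    have f_index: "f a $$ (i, j) = (\<Sum>k<n. \<Sum>k'<n. cnj (e a $ k) * e a $ k' * X $$ (k, k'))"
      if "a < n" for a
    proof -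
      have "f a $$ (i, j)
          = (\<Sum>l<n. \<Sum>l'<n. ?R a $$ (i, l') * \<rho> $$ (l', l) * cnj (?R a $$ (j, l)))"
        unfolding f_def by (rule sandwich_index) (use R[OF that] \<rho> ij in auto)
      also have "\<dots> = (\<Sum>l<n. \<Sum>l'<n. \<Sum>k<n. \<Sum>k'<n.
          cnj (e a $ k) * e a $ k' * (A i $$ (k, l') * \<rho> $$ (l', l) * cnj (A j $$ (k', l))))"
      proof (intro sum.cong refl)
        fix l l' assume "l \<in> {..<n}" "l' \<in> {..<n}"
        then have "?R a $$ (i, l') * \<rho> $$ (l', l) * cnj (?R a $$ (j, l))
            = (\<Sum>k<n. cnj (e a $ k) * A i $$ (k, l')) * \<rho> $$ (l', l)
              * (\<Sum>k'<n. e a $ k' * cnj (A j $$ (k', l)))"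
          using R_index ij that by simp
        also have "\<dots> = (\<Sum>k<n. cnj (e a $ k) * A i $$ (k, l') * \<rho> $$ (l', l))
              * (\<Sum>k'<n. e a $ k' * cnj (A j $$ (k', l)))"
          by (simp only: sum_distrib_right)
        also have "\<dots> = (\<Sum>k<n. \<Sum>k'<n. cnj (e a $ k) * A i $$ (k, l') * \<rho> $$ (l', l)
              * (e a $ k' * cnj (A j $$ (k', l))))"
          by (rule sum_product)
        also have "\<dots> = (\<Sum>k<n. \<Sum>k'<n.
            cnj (e a $ k) * e a $ k' * (A i $$ (k, l') * \<rho> $$ (l', l) * cnj (A j $$ (k', l))))"
          by (intro sum.cong refl) (simp only: mult_ac)
        finally show "?R a $$ (i, l') * \<rho> $$ (l', l) * cnj (?R a $$ (j, l))
            = (\<Sum>k<n. \<Sum>k'<n.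
                cnj (e a $ k) * e a $ k' * (A i $$ (k, l') * \<rho> $$ (l', l) * cnj (A j $$ (k', l))))" .
      qed
      also have "\<dots> = (\<Sum>k<n. \<Sum>k'<n. \<Sum>l<n. \<Sum>l'<n.
          cnj (e a $ k) * e a $ k' * (A i $$ (k, l') * \<rho> $$ (l', l) * cnj (A j $$ (k', l))))"
        (is "(\<Sum>l<n. \<Sum>l'<n. \<Sum>k<n. \<Sum>k'<n. ?t l l' k k') = _")
      proof -
        have "(\<Sum>l<n. \<Sum>l'<n. \<Sum>k<n. \<Sum>k'<n. ?t l l' k k')
            = (\<Sum>l<n. \<Sum>k<n. \<Sum>l'<n. \<Sum>k'<n. ?t l l' k k')"
          by (rule sum.cong[OF refl], rule sum.swap)
        also have "\<dots> = (\<Sum>k<n. \<Sum>l<n. \<Sum>l'<n. \<Sum>k'<n. ?t l l' k k')"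
          by (rule sum.swap)
        also have "\<dots> = (\<Sum>k<n. \<Sum>l<n. \<Sum>k'<n. \<Sum>l'<n. ?t l l' k k')"
          by (rule sum.cong[OF refl], rule sum.cong[OF refl], rule sum.swap)
        also have "\<dots> = (\<Sum>k<n. \<Sum>k'<n. \<Sum>l<n. \<Sum>l'<n. ?t l l' k k')"
          by (rule sum.cong[OF refl], rule sum.swap)
        finally show ?thesis .
      qed
      also have "\<dots> = (\<Sum>k<n. \<Sum>k'<n. cnj (e a $ k) * e a $ k' * X $$ (k, k'))"
        by (intro sum.cong refl) (simp add: X sum_distrib_left)
      finally show ?thesis .
    qed
    have "finsum (module_mat TYPE(complex) r r) f {..<n} $$ (i, j) = (\<Sum>a<n. f a $$ (i, j))"
      using fin f ij by simp
    also have "\<dots> = (\<Sum>a<n. \<Sum>k<n. \<Sum>k'<n. cnj (e a $ k) * e a $ k' * X $$ (k, k'))"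
      by (simp add: f_index)
    also have "\<dots> = (\<Sum>k<n. \<Sum>a<n. \<Sum>k'<n. cnj (e a $ k) * e a $ k' * X $$ (k, k'))"
      by (rule sum.swap)
    also have "\<dots> = (\<Sum>k<n. \<Sum>k'<n. \<Sum>a<n. cnj (e a $ k) * e a $ k' * X $$ (k, k'))"
      by (rule sum.cong[OF refl], rule sum.swap)
    also have "\<dots> = (\<Sum>k<n. \<Sum>k'<n. if k = k' then X $$ (k, k') else 0)"
      by (intro sum.cong refl)
        (simp add: orthonormal_basis_resolution[OF e] flip: sum_distrib_right)
    also have "\<dots> = mat_trace X"
      using Ai by (simp add: mat_trace_def X_def)
    finally show "complementary_channel r A \<rho> $$ (i, j)
        = finsum (module_mat TYPE(complex) r r) f {..<n} $$ (i, j)"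
      using ij by (simp add: complementary_channel_def X_def)
  qed (use fin f in \<open>auto simp: complementary_channel_def\<close>)
  then show "complementary_channel r A \<rho>
      = (\<Oplus>\<^bsub>module_mat TYPE(complex) r r\<^esub> i \<in> {..<n}. ?R i * \<rho> * mat_adjoint (?R i))"
    by (simp add: f_def[abs_def])
qed

end

theory Submission
  imports Defs "Jordan_Normal_Form.Spectral_Radius"
begin

text \<open>
  The operator \<open>R\<^sub>b\<^sup>* R\<^sub>a\<close> is the value of the trace-dual \<open>\<Psi>(X) = \<Sum>\<^sub>i A\<^sub>i\<^sup>* X A\<^sub>i\<close> of the twirl \<open>\<Phi>\<close> at
  \<open>|e\<^sub>b\<rangle>\<langle>e\<^sub>a|\<close>, so the operator system is the range of \<open>\<Psi>\<close>. By left invariance \<open>\<Phi>\<close> maps into the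
  commutant of the representation, and \<open>\<Psi>\<close> fixes the commutant pointwise; this forces \<open>\<Psi> = \<Phi>\<close>, and
  the operator system is the commutant. By Schur's lemma the commutant is conjugate under \<open>U\<close> to
  \<open>\<Oplus>\<^sub>\<alpha> (B(\<complex>\<^bsup>m\<^sub>\<alpha>\<^esup>) \<otimes> 1)\<close>, whose matrix units \<open>|t\<rangle>\<langle>u| \<otimes> 1\<close> form a basis.
\<close>

subsection \<open>Matrices\<close>

text \<open>The Kraus family is arbitrary, so all knowledge of \<Psi> has to come from the identity
  tr(\<Psi>(X) \<rho>) = tr(X \<Phi>(\<rho>)), which determines \<Psi> because the trace form is
  nondegenerate; hence the result does not depend on the choice of \<open>A\<close> and
  \<open>r\<close>. The textbook route to \<Psi> = \<Phi> substitutes the inverse of g in the Haar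
  integral. The measure is given with left invariance, so the symmetry is extracted differently: if
  X commutes with every \<open>\<pi> g\<close>, cyclicity of the trace gives tr(X \<Phi>(\<rho>)) =
  tr(X \<rho>), and values of \<Phi> are such X. The operator system is the whole range of \<Psi>
  because the operators |e_b><e_a| span all matrices. The obstacle in the second half is that block
  and Kronecker structure is hidden in single natural-number indices. Coordinates are therefore
  relabelled by triples (block, copy, index), after which Schur's lemma applies to each small block.
  The dimension is counted with explicit dual functionals, so that linear independence becomes an
  evaluation of entries.\<close>

lemma triple_mult_index:
  fixes X Y Z :: "complex mat"
  assumes "X \<in> carrier_mat p n" "Y \<in> carrier_mat n k" "Z \<in> carrier_mat k q" "i < p" "j < q"
  shows "(X * Y * Z) $$ (i, j) = (\<Sum>l<k. \<Sum>l'<n. X $$ (i, l') * Y $$ (l', l) * Z $$ (l, j))"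
  using assms
  by (auto simp: scalar_prod_def lessThan_atLeast0 sum_distrib_right
      simp del: assoc_mult_mat intro!: sum.cong)

text \<open>Linearity of a two-sided product in its middle factor, in terms of entries. It carries
  expansions through conjugation by \<open>U\<close> and through each Kraus term.\<close>

lemma triple_mult_sum_index:
  fixes X Y Z :: "complex mat"
  assumes X: "X \<in> carrier_mat p n" and Y: "Y \<in> carrier_mat n k" and Z: "Z \<in> carrier_mat k q"
    and f: "\<And>t. t \<in> I \<Longrightarrow> f t \<in> carrier_mat n k"
    and eq: "\<And>x y. x < n \<Longrightarrow> y < k \<Longrightarrow> Y $$ (x, y) = (\<Sum>t\<in>I. c t * f t $$ (x, y))"
    and ij: "i < p" "j < q"
  shows "(X * Y * Z) $$ (i, j) = (\<Sum>t\<in>I. c t * (X * f t * Z) $$ (i, j))"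
proof -
  have "(X * Y * Z) $$ (i, j)
      = (\<Sum>l<k. \<Sum>l'<n. \<Sum>t\<in>I. c t * (X $$ (i, l') * f t $$ (l', l) * Z $$ (l, j)))"
    unfolding triple_mult_index[OF X Y Z ij]
    by (intro sum.cong refl) (simp add: eq sum_distrib_left sum_distrib_right mult_ac)
  also have "\<dots> = (\<Sum>l<k. \<Sum>t\<in>I. \<Sum>l'<n. c t * (X $$ (i, l') * f t $$ (l', l) * Z $$ (l, j)))"
    by (rule sum.cong[OF refl], rule sum.swap)
  also have "\<dots> = (\<Sum>t\<in>I. \<Sum>l<k. \<Sum>l'<n. c t * (X $$ (i, l') * f t $$ (l', l) * Z $$ (l, j)))"
    by (rule sum.swap)
  also have "\<dots> = (\<Sum>t\<in>I. c t * (X * f t * Z) $$ (i, j))"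
    by (intro sum.cong refl) (simp add: triple_mult_index[OF X f Z ij] sum_distrib_left)
  finally show ?thesis .
qed

lemma mat_trace_mult:
  assumes "X \<in> carrier_mat p q" "Y \<in> carrier_mat q p"
  shows "mat_trace (X * Y) = (\<Sum>k<p. \<Sum>l<q. X $$ (k, l) * Y $$ (l, k))"
  using assms by (auto simp: mat_trace_def scalar_prod_def lessThan_atLeast0 intro!: sum.cong)

lemma mat_trace_mult_commute:
  assumes "X \<in> carrier_mat p q" "Y \<in> carrier_mat q p"
  shows "mat_trace (X * Y) = mat_trace (Y * X)"
  unfolding mat_trace_mult[OF assms] mat_trace_mult[OF assms(2,1)]
  by (subst sum.swap) (simp add: mult.commute)

text \<open>Nondegeneracy of the trace form: pairing with a matrix unit reads off a single
  entry.\<close>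

lemma mat_eq_by_traceI:
  fixes X Y :: "complex mat"
  assumes X: "X \<in> carrier_mat n n" and Y: "Y \<in> carrier_mat n n"
    and eq: "\<And>\<rho>. \<rho> \<in> carrier_mat n n \<Longrightarrow> mat_trace (X * \<rho>) = mat_trace (Y * \<rho>)"
  shows "X = Y"
proof (rule eq_matI)
  fix i j assume "i < dim_row Y" "j < dim_col Y"
  then have ij: "i < n" "j < n" using Y by auto
  \<comment> \<open>The matrix unit with its 1 in row \<open>j\<close> and column \<open>i\<close>,
    transposed because the trace pairs entry (k, l) with entry (l, k). The nested conditionals let
    the two sums collapse one after the other.\<close>
  define E :: "complex mat" where "E = mat n n (\<lambda>(l, k). if k = i then if l = j then 1 else 0 else 0)"
  have E: "E \<in> carrier_mat n n" by (simp add: E_def)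
  have "mat_trace (Z * E) = Z $$ (i, j)" if Z: "Z \<in> carrier_mat n n" for Z
  proof -
    have "mat_trace (Z * E)
        = (\<Sum>k<n. \<Sum>l<n. if k = i then if l = j then Z $$ (k, l) else 0 else 0)"
      unfolding mat_trace_mult[OF Z E] by (intro sum.cong refl) (simp add: E_def)
    also have "\<dots> = (\<Sum>k<n. if k = i then Z $$ (k, j) else 0)"
      using ij by (intro sum.cong refl) simp
    also have "\<dots> = Z $$ (i, j)" using ij by simp
    finally show ?thesis .
  qed
  then show "X $$ (i, j) = Y $$ (i, j)" using eq[OF E] X Y by simp
qed (use X Y in auto)

section \<open>Subspaces of matrices and their dimension\<close>

lemma submodule_mat_sum_closed:
  fixes f :: "'i \<Rightarrow> complex mat"
  assumes S: "submodule class_ring S (module_mat TYPE(complex) p q)"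
    and "finite I" and f: "\<And>i. i \<in> I \<Longrightarrow> f i \<in> S"
  shows "mat p q (\<lambda>(k, l). \<Sum>i\<in>I. c i * f i $$ (k, l)) \<in> S"
  using \<open>finite I\<close> f
proof (induction I rule: finite_induct)
  case empty
  have "0\<^sub>m p q \<in> S"
    using submodule.zero_closed[OF S] by (simp add: module_mat_simps)
  moreover have "0\<^sub>m p q = mat p q (\<lambda>(k, l). \<Sum>i\<in>{}. c i * f i $$ (k, l))"
    by (rule eq_matI) auto
  ultimately show ?case by (simp only:)
next
  case (insert x I)
  let ?g = "mat p q (\<lambda>(k, l). \<Sum>i\<in>I. c i * f i $$ (k, l))"
  have x: "f x \<in> carrier_mat p q"
    using submodule.subset[OF S] insert.prems[of x] by (auto simp: module_mat_simps)
  have "c x \<cdot>\<^sub>m f x \<in> S"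
    using submodule.smult_closed[OF S, of "c x" "f x"] insert.prems[of x]
    by (simp add: module_mat_simps class_ring_simps)
  moreover have "?g \<in> S" using insert.IH insert.prems by blast
  ultimately have "c x \<cdot>\<^sub>m f x + ?g \<in> S"
    using submodule.m_closed[OF S] by (simp add: module_mat_simps)
  moreover have "c x \<cdot>\<^sub>m f x + ?g = mat p q (\<lambda>(k, l). \<Sum>i\<in>insert x I. c i * f i $$ (k, l))"
    by (rule eq_matI) (use x insert in auto)
  ultimately show ?case by (simp only:)
qed

text \<open>The matrices \<open>Y i\<close> represent linear functionals dual to the family \<open>f\<close>.\<close>

lemma mat_subspace_dim_eqI:
  fixes f Y :: "'i \<Rightarrow> complex mat"
  assumes S: "submodule class_ring S (module_mat TYPE(complex) n n)"
    and fin: "finite I" and f: "\<And>i. i \<in> I \<Longrightarrow> f i \<in> S"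
    and expand: "\<And>X. X \<in> S \<Longrightarrow>
      \<exists>c. \<forall>k<n. \<forall>l<n. X $$ (k, l) = (\<Sum>i\<in>I. c i * f i $$ (k, l))"
    and dual: "\<And>i j. i \<in> I \<Longrightarrow> j \<in> I \<Longrightarrow>
      (\<Sum>k<n. \<Sum>l<n. Y i $$ (k, l) * f j $$ (k, l)) = (if i = j then 1 else 0)"
  shows "mat_subspace_dim n S = card I"
proof -
  interpret V: vectorspace class_ring "module_mat TYPE(complex) n n"
    by (rule matrix_vs)
  have sub: "VectorSpace.subspace class_ring S (module_mat TYPE(complex) n n)"
    using S V.vectorspace_axioms by (simp add: VectorSpace.subspace_def)
  interpret W: vectorspace class_ring "(module_mat TYPE(complex) n n)\<lparr>carrier := S\<rparr>"
    using V.subspace_is_vs[OF sub] .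
  have Sc: "S \<subseteq> carrier_mat n n"
    using submodule.subset[OF S] by (simp add: module_mat_simps)
  have inj: "inj_on f I"
  proof (rule inj_onI)
    fix i j assume ij: "i \<in> I" "j \<in> I" "f i = f j"
    then show "i = j" using dual[of i i] dual[of i j] by (auto split: if_splits)
  qed
  have fS: "f ` I \<subseteq> S" using f by auto
  have lincomb_index: "V.lincomb a B $$ (k, l) = (\<Sum>v\<in>B. a v * v $$ (k, l))"
    if "finite B" "B \<subseteq> S" "k < n" "l < n" for a B k l
  proof -
    have "\<And>v. v \<in> B \<Longrightarrow> a v \<cdot>\<^sub>m v \<in> carrier_mat n n" using that(2) Sc by auto
    from finsum_mat_carrier_index[OF that(1) this] that(3,4)
    have "V.lincomb a B $$ (k, l) = (\<Sum>v\<in>B. (a v \<cdot>\<^sub>m v) $$ (k, l))"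
      by (simp add: V.lincomb_def module_mat_simps)
    also have "\<dots> = (\<Sum>v\<in>B. a v * v $$ (k, l))"
      by (rule sum.cong) (use that Sc in auto)
    finally show ?thesis .
  qed
  have "\<not> V.lin_dep (f ` I)"
  proof
    assume "V.lin_dep (f ` I)"
    then obtain B a v where B: "finite B" "B \<subseteq> f ` I"
      "V.lincomb a B = 0\<^sub>m n n" "v \<in> B" "a v \<noteq> 0"
      by (auto simp: V.lin_dep_def module_mat_simps class_ring_simps)
    obtain i where i: "i \<in> I" "v = f i" using B by auto
    have BS: "B \<subseteq> S" using B fS by auto
    have delta: "(\<Sum>k<n. \<Sum>l<n. Y i $$ (k, l) * w $$ (k, l)) = (if w = v then 1 else 0)"
      if w: "w \<in> B" for w
    proof -
      obtain j where "j \<in> I" "w = f j" using subsetD[OF B(2) w] by blast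
      then show ?thesis using dual[OF i(1), of j] i inj by (auto dest: inj_onD)
    qed
    \<comment> \<open>Pairing the vanishing combination with the functional dual to \<open>v\<close>
      isolates the coefficient \<open>a v\<close>, which was assumed nonzero.\<close>
    have "0 = (\<Sum>k<n. \<Sum>l<n. Y i $$ (k, l) * V.lincomb a B $$ (k, l))"
      using B(3) by simp
    also have "\<dots> = (\<Sum>k<n. \<Sum>l<n. \<Sum>w\<in>B. a w * (Y i $$ (k, l) * w $$ (k, l)))"
      by (simp add: lincomb_index[OF B(1) BS] sum_distrib_left mult_ac)
    also have "\<dots> = (\<Sum>k<n. \<Sum>w\<in>B. \<Sum>l<n. a w * (Y i $$ (k, l) * w $$ (k, l)))"
      by (rule sum.cong[OF refl], rule sum.swap)
    also have "\<dots> = (\<Sum>w\<in>B. \<Sum>k<n. \<Sum>l<n. a w * (Y i $$ (k, l) * w $$ (k, l)))"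
      by (rule sum.swap)
    also have "\<dots> = (\<Sum>w\<in>B. if w = v then a w else 0)"
      using delta by (intro sum.cong refl) (simp flip: sum_distrib_left)
    also have "\<dots> = a v" using B(1,4) by simp
    finally show False using B by simp
  qed
  moreover have "V.span (f ` I) = S"
  proof
    show "V.span (f ` I) \<subseteq> S" using V.span_is_subset[OF fS S] .
    show "S \<subseteq> V.span (f ` I)"
    proof
      fix X assume X: "X \<in> S"
      from expand[OF X] obtain c where
        c: "\<And>k l. k < n \<Longrightarrow> l < n \<Longrightarrow> X $$ (k, l) = (\<Sum>i\<in>I. c i * f i $$ (k, l))"
        by blast
      have sp: "submodule class_ring (V.span (f ` I)) (module_mat TYPE(complex) n n)"
        using fS Sc by (intro V.span_is_submodule) (auto simp: module_mat_simps)
      have "mat n n (\<lambda>(k, l). \<Sum>i\<in>I. c i * f i $$ (k, l)) \<in> V.span (f ` I)"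
        using fS Sc
        by (intro submodule_mat_sum_closed[OF sp fin] subsetD[OF V.in_own_span])
           (auto simp: module_mat_simps)
      moreover have "X = mat n n (\<lambda>(k, l). \<Sum>i\<in>I. c i * f i $$ (k, l))"
        by (rule eq_matI) (use X Sc c in auto)
      ultimately show "X \<in> V.span (f ` I)" by simp
    qed
  qed
  ultimately have "W.basis (f ` I)"
    using V.span_li_not_depend[OF fS S] fS by (simp add: W.basis_def)
  from W.dim_basis[OF _ this] show ?thesis
    using fin card_image[OF inj] by (simp add: mat_subspace_dim_def)
qed

section \<open>Commutants\<close>

definition commutant :: "nat \<Rightarrow> complex mat set \<Rightarrow> complex mat set" where
  "commutant n P = {X \<in> carrier_mat n n. \<forall>Y \<in> P. X * Y = Y * X}"

lemma submodule_commutant: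
  assumes "P \<subseteq> carrier_mat n n"
  shows "submodule class_ring (commutant n P) (module_mat TYPE(complex) n n)"
proof -
  have "vectorspace class_ring (module_mat TYPE(complex) n n)" by (rule matrix_vs)
  then have "module class_ring (module_mat TYPE(complex) n n)" by (simp add: vectorspace_def)
  moreover have "X + X' \<in> commutant n P" if "X \<in> commutant n P" "X' \<in> commutant n P" for X X'
    using that assms
    by (auto simp: commutant_def add_mult_distrib_mat[of _ n n] mult_add_distrib_mat[of _ n n _ n] subset_iff)
  moreover have "c \<cdot>\<^sub>m X \<in> commutant n P" if "X \<in> commutant n P" for X c
    using that assms
    by (auto simp: commutant_def mult_smult_assoc_mat[of _ n n] mult_smult_distrib[of _ n n] subset_iff)
  moreover have "0\<^sub>m n n \<in> commutant n P"
    using assms by (auto simp: commutant_def subset_iff)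
  ultimately show ?thesis
    by (auto simp: submodule_def module_mat_simps commutant_def[of n P])
qed

subsection \<open>Schur's lemma\<close>

lemma subspace_vecI:
  fixes W :: "complex vec set"
  assumes "W \<subseteq> carrier_vec n" "0\<^sub>v n \<in> W"
    and "\<And>v w. v \<in> W \<Longrightarrow> w \<in> W \<Longrightarrow> v + w \<in> W"
    and "\<And>c v. v \<in> W \<Longrightarrow> c \<cdot>\<^sub>v v \<in> W"
  shows "VectorSpace.subspace class_ring W (module_vec TYPE(complex) n)"
  using assms vec_vs[where 'a = complex] vec_module[where 'a = complex]
  by (auto simp: VectorSpace.subspace_def submodule_def module_vec_simps class_ring_simps)

lemma mult_mat_vec_unit_index:
  fixes X :: "complex mat"
  assumes "X \<in> carrier_mat k n" "i < k" "j < n"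
  shows "(X *\<^sub>v unit_vec n j) $ i = X $$ (i, j)"
  using assms by auto

lemma eq_mat_by_vecI:
  fixes X Y :: "complex mat"
  assumes X: "X \<in> carrier_mat k n" and Y: "Y \<in> carrier_mat k n"
    and eq: "\<And>v. v \<in> carrier_vec n \<Longrightarrow> X *\<^sub>v v = Y *\<^sub>v v"
  shows "X = Y"
proof (rule eq_matI)
  fix i j assume "i < dim_row Y" "j < dim_col Y"
  then have ij: "i < k" "j < n" using Y by auto
  then show "X $$ (i, j) = Y $$ (i, j)"
    using eq[of "unit_vec n j"] mult_mat_vec_unit_index[OF X ij] mult_mat_vec_unit_index[OF Y ij]
    by simp
qed (use X Y in auto)

text \<open>Preimages of the unit vectors are the columns of a right inverse \<open>B\<close>. It is
  also a left inverse, since \<open>X\<close> sends B(Xw) - w to 0 and has trivial kernel. What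
  remains is that \<open>X\<close> is square, which \<open>invertible_mat\<close> demands.\<close>

lemma bijective_mat_invertible:
  fixes X :: "complex mat"
  assumes X: "X \<in> carrier_mat k n"
    and ker: "\<And>v. v \<in> carrier_vec n \<Longrightarrow> X *\<^sub>v v = 0\<^sub>v k \<Longrightarrow> v = 0\<^sub>v n"
    and range: "\<And>w. w \<in> carrier_vec k \<Longrightarrow> \<exists>v \<in> carrier_vec n. X *\<^sub>v v = w"
  shows "invertible_mat X"
proof -
  have "\<forall>i. \<exists>v \<in> carrier_vec n. X *\<^sub>v v = unit_vec k i"
    using range by auto
  then obtain v where v: "\<And>i. v i \<in> carrier_vec n" "\<And>i. X *\<^sub>v v i = unit_vec k i"
    by metis
  define B where "B = mat n k (\<lambda>(a, i). v i $ a)"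
  have B: "B \<in> carrier_mat n k" by (simp add: B_def)
  have XB: "X * B = 1\<^sub>m k"
  proof (rule eq_matI)
    fix a i assume "a < dim_row (1\<^sub>m k :: complex mat)" "i < dim_col (1\<^sub>m k :: complex mat)"
    then have ai: "a < k" "i < k" by auto
    have "col B i = v i" using ai v(1)[of i] by (auto simp: B_def)
    then have "(X * B) $$ (a, i) = (X *\<^sub>v v i) $ a"
      using ai X B by simp
    also have "\<dots> = 1\<^sub>m k $$ (a, i)" using ai by (simp add: v(2))
    finally show "(X * B) $$ (a, i) = 1\<^sub>m k $$ (a, i)" .
  qed (use X B in auto)
  have BX: "B * X = 1\<^sub>m n"
  proof (rule eq_mat_by_vecI)
    fix w :: "complex vec" assume w: "w \<in> carrier_vec n"
    have Xw: "X *\<^sub>v w \<in> carrier_vec k" using X w by simp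
    have BXw: "B *\<^sub>v (X *\<^sub>v w) \<in> carrier_vec n" using B Xw by simp
    have "X *\<^sub>v (B *\<^sub>v (X *\<^sub>v w)) = (X * B) *\<^sub>v (X *\<^sub>v w)"
      using X B Xw by (simp add: assoc_mult_mat_vec)
    also have "\<dots> = X *\<^sub>v w" using Xw by (simp add: XB)
    finally have "X *\<^sub>v (B *\<^sub>v (X *\<^sub>v w) - w) = 0\<^sub>v k"
      using X BXw w Xw by (simp add: mult_minus_distrib_mat_vec)
    then have "B *\<^sub>v (X *\<^sub>v w) - w = 0\<^sub>v n" using ker BXw w by simp
    then have "B *\<^sub>v (X *\<^sub>v w) = w"
      using BXw w by (metis carrier_vecD index_minus_vec(1) index_zero_vec(1) eq_vecI right_minus_eq)
    then show "(B * X) *\<^sub>v w = 1\<^sub>m n *\<^sub>v w"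
      using X B w by (simp add: assoc_mult_mat_vec)
  qed (use X B in auto)
  \<comment> \<open>Squareness from the trace: k = tr(XB) = tr(BX) = n, an equation of complex
    numbers and hence of naturals.\<close>
  have "of_nat k = (\<Sum>i<k. (X * B) $$ (i, i))" by (simp add: XB)
  also have "\<dots> = (\<Sum>i<k. \<Sum>a<n. X $$ (i, a) * B $$ (a, i))"
    using X B by (auto simp: scalar_prod_def lessThan_atLeast0 intro!: sum.cong)
  also have "\<dots> = (\<Sum>a<n. \<Sum>i<k. B $$ (a, i) * X $$ (i, a))"
    by (subst sum.swap) (simp add: mult.commute)
  also have "\<dots> = (\<Sum>a<n. (B * X) $$ (a, a))"
    using X B by (auto simp: scalar_prod_def lessThan_atLeast0 intro!: sum.cong)
  also have "\<dots> = of_nat n" by (simp add: BX)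
  finally have "k = n" by simp
  then show ?thesis
    using X B XB BX by (auto simp: invertible_mat_def inverts_mat_def intro!: exI[of _ B])
qed

text \<open>Kernel and range of an intertwiner are invariant subspaces. If \<open>X\<close> is
  nonzero, the kernel is not everything and the range is not zero, so irreducibility makes
  \<open>X\<close> bijective and thus an equivalence.\<close>

lemma schur_inequivalent:
  assumes \<rho>: "\<And>g. g \<in> carrier G \<Longrightarrow> \<rho> g \<in> carrier_mat n n"
    and \<sigma>: "\<And>g. g \<in> carrier G \<Longrightarrow> \<sigma> g \<in> carrier_mat k k"
    and irr: "irreducible_rep G n \<rho>" "irreducible_rep G k \<sigma>"
    and X: "X \<in> carrier_mat k n"
    and inter: "\<And>g. g \<in> carrier G \<Longrightarrow> X * \<rho> g = \<sigma> g * X"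
    and neq: "\<not> equivalent_reps G n \<rho> k \<sigma>"
  shows "X = 0\<^sub>m k n"
proof (rule ccontr)
  assume nz: "X \<noteq> 0\<^sub>m k n"
  have comm: "X *\<^sub>v (\<rho> g *\<^sub>v v) = \<sigma> g *\<^sub>v (X *\<^sub>v v)"
    if "g \<in> carrier G" "v \<in> carrier_vec n" for g v
    using assoc_mult_mat_vec[OF X \<rho>[OF that(1)] that(2)]
      assoc_mult_mat_vec[OF \<sigma>[OF that(1)] X that(2)] inter[OF that(1)] by simp
  have not_all: "\<not> (\<forall>v \<in> carrier_vec n. X *\<^sub>v v = 0\<^sub>v k)"
  proof
    assume "\<forall>v \<in> carrier_vec n. X *\<^sub>v v = 0\<^sub>v k"
    then have "X = 0\<^sub>m k n"
      by (intro eq_mat_by_vecI[OF X]) auto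
    with nz show False by simp
  qed
  define W where "W = {v \<in> carrier_vec n. X *\<^sub>v v = 0\<^sub>v k}"
  have "VectorSpace.subspace class_ring W (module_vec TYPE(complex) n)"
    using X by (intro subspace_vecI)
      (auto simp: W_def mult_add_distrib_mat_vec mult_mat_vec)
  moreover have "\<forall>g \<in> carrier G. \<forall>w \<in> W. \<rho> g *\<^sub>v w \<in> W"
    using \<rho> \<sigma> comm by (fastforce simp: W_def)
  ultimately have "W = {0\<^sub>v n} \<or> W = carrier_vec n"
    using irr(1) by (simp add: irreducible_rep_def)
  then have W: "W = {0\<^sub>v n}" using not_all by (auto simp: W_def)
  define R where "R = (\<lambda>v. X *\<^sub>v v) ` carrier_vec n"
  have "VectorSpace.subspace class_ring R (module_vec TYPE(complex) k)"
  proof (rule subspace_vecI)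
    show "R \<subseteq> carrier_vec k" using X by (auto simp: R_def)
    have "0\<^sub>v k = X *\<^sub>v 0\<^sub>v n" using X by auto
    then show "0\<^sub>v k \<in> R" unfolding R_def by (metis image_eqI zero_carrier_vec)
    show "v + w \<in> R" if "v \<in> R" "w \<in> R" for v w
    proof -
      obtain a b where "a \<in> carrier_vec n" "b \<in> carrier_vec n" "v = X *\<^sub>v a" "w = X *\<^sub>v b"
        using \<open>v \<in> R\<close> \<open>w \<in> R\<close> unfolding R_def by blast
      then show ?thesis
        using X by (auto simp: R_def mult_add_distrib_mat_vec intro!: image_eqI[of _ _ "a + b"])
    qed
    show "c \<cdot>\<^sub>v v \<in> R" if v: "v \<in> R" for c v
    proof -
      obtain a where "a \<in> carrier_vec n" "v = X *\<^sub>v a"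
        using v unfolding R_def by blast
      then show ?thesis
        using X by (auto simp: R_def mult_mat_vec intro!: image_eqI[of _ _ "c \<cdot>\<^sub>v a"])
    qed
  qed
  moreover have "\<forall>g \<in> carrier G. \<forall>w \<in> R. \<sigma> g *\<^sub>v w \<in> R"
  proof (intro ballI)
    fix g w assume g: "g \<in> carrier G" and "w \<in> R"
    then obtain a where "a \<in> carrier_vec n" "w = X *\<^sub>v a" unfolding R_def by blast
    then show "\<sigma> g *\<^sub>v w \<in> R"
      using comm[OF g] \<rho>[OF g] unfolding R_def by (intro image_eqI[of _ _ "\<rho> g *\<^sub>v a"]) auto
  qed
  ultimately have "R = {0\<^sub>v k} \<or> R = carrier_vec k"
    using irr(2) by (simp add: irreducible_rep_def)
  then have R: "R = carrier_vec k" using not_all unfolding R_def by blast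
  have "invertible_mat X"
  proof (rule bijective_mat_invertible[OF X])
    show "v = 0\<^sub>v n" if "v \<in> carrier_vec n" "X *\<^sub>v v = 0\<^sub>v k" for v
    proof -
      have "v \<in> W" using that by (simp add: W_def)
      then show ?thesis using W by blast
    qed
    show "\<exists>v \<in> carrier_vec n. X *\<^sub>v v = w" if "w \<in> carrier_vec k" for w
    proof -
      have "w \<in> R" using that R by simp
      then show ?thesis unfolding R_def by blast
    qed
  qed
  then show False using neq X inter by (auto simp: equivalent_reps_def)
qed

text \<open>Over the complex numbers, and with \<open>n > 0\<close> from irreducibility,
  \<open>X\<close> has an eigenvalue. Its eigenspace is invariant and nonzero, hence the whole
  space.\<close>

lemma schur_scalar:
  assumes \<rho>: "\<And>g. g \<in> carrier G \<Longrightarrow> \<rho> g \<in> carrier_mat n n"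
    and irr: "irreducible_rep G n \<rho>"
    and X: "X \<in> carrier_mat n n"
    and inter: "\<And>g. g \<in> carrier G \<Longrightarrow> X * \<rho> g = \<rho> g * X"
  obtains c where "X = c \<cdot>\<^sub>m 1\<^sub>m n"
proof -
  have "n > 0" using irr by (simp add: irreducible_rep_def)
  then obtain c v where v: "v \<in> carrier_vec n" "v \<noteq> 0\<^sub>v n" "X *\<^sub>v v = c \<cdot>\<^sub>v v"
    using spectrum_non_empty[OF X] X
    by (auto simp: spectrum_def eigenvalue_def eigenvector_def)
  define W where "W = {v \<in> carrier_vec n. X *\<^sub>v v = c \<cdot>\<^sub>v v}"
  have "VectorSpace.subspace class_ring W (module_vec TYPE(complex) n)"
    using X by (intro subspace_vecI)
      (auto simp: W_def mult_add_distrib_mat_vec mult_mat_vec smult_add_distrib_vec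
        smult_smult_assoc mult.commute)
  moreover have "\<rho> g *\<^sub>v w \<in> W" if g: "g \<in> carrier G" and "w \<in> W" for g w
  proof -
    have w: "w \<in> carrier_vec n" "X *\<^sub>v w = c \<cdot>\<^sub>v w" using \<open>w \<in> W\<close> by (auto simp: W_def)
    have "X *\<^sub>v (\<rho> g *\<^sub>v w) = \<rho> g *\<^sub>v (X *\<^sub>v w)"
      using assoc_mult_mat_vec[OF X \<rho>[OF g] w(1)] assoc_mult_mat_vec[OF \<rho>[OF g] X w(1)]
        inter[OF g] by simp
    also have "\<dots> = c \<cdot>\<^sub>v (\<rho> g *\<^sub>v w)" using \<rho>[OF g] w by (simp add: mult_mat_vec)
    finally show ?thesis using \<rho>[OF g] w by (simp add: W_def)
  qed
  ultimately have "W = {0\<^sub>v n} \<or> W = carrier_vec n"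
    using irr by (simp add: irreducible_rep_def)
  moreover have "v \<in> W" using v by (simp add: W_def)
  ultimately have W: "W = carrier_vec n" using v by blast
  have "X = c \<cdot>\<^sub>m 1\<^sub>m n"
  proof (rule eq_mat_by_vecI[OF X])
    fix w :: "complex vec" assume w: "w \<in> carrier_vec n"
    then have "X *\<^sub>v w = c \<cdot>\<^sub>v w" using W by (auto simp: W_def)
    also have "\<dots> = (c \<cdot>\<^sub>m 1\<^sub>m n) *\<^sub>v w"
      using w by (intro eq_vecI) (auto simp: smult_scalar_prod_distrib[of _ n])
    finally show "X *\<^sub>v w = (c \<cdot>\<^sub>m 1\<^sub>m n) *\<^sub>v w" .
  qed simp
  then show thesis by (rule that)
qed

subsection \<open>Block-diagonal matrices with multiplicities\<close>

lemma sum_block_position_less: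
  fixes D :: "nat \<Rightarrow> nat"
  assumes "\<alpha> < s" "i < D \<alpha>"
  shows "(\<Sum>\<gamma><\<alpha>. D \<gamma>) + i < (\<Sum>\<gamma><s. D \<gamma>)"
proof -
  have "(\<Sum>\<gamma><\<alpha>. D \<gamma>) + i < (\<Sum>\<gamma><Suc \<alpha>. D \<gamma>)" using assms by simp
  also have "\<dots> \<le> (\<Sum>\<gamma><s. D \<gamma>)" using assms by (intro sum_mono2) auto
  finally show ?thesis .
qed

lemma diag_block_mat_map_carrier:
  assumes "\<And>\<gamma>. \<gamma> < s \<Longrightarrow> F \<gamma> \<in> carrier_mat (D \<gamma>) (D \<gamma>)"
  shows "diag_block_mat (map F [0..<s]) \<in> carrier_mat (\<Sum>\<gamma><s. D \<gamma>) (\<Sum>\<gamma><s. D \<gamma>)"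
  using assms
proof (induction s)
  case (Suc s)
  from Suc.prems[of s] Suc.IH Suc.prems show ?case
    by (auto simp: diag_block_mat_last Let_def)
qed simp

text \<open>The offset of a block is the sum of the sizes before it, so appending a block leaves
  earlier offsets unchanged. The induction therefore splits off the last block as a
  \<open>four_block_mat\<close>.\<close>

lemma diag_block_mat_map_index:
  assumes "\<And>\<gamma>. \<gamma> < s \<Longrightarrow> F \<gamma> \<in> carrier_mat (D \<gamma>) (D \<gamma>)"
    and "\<alpha> < s" "\<beta> < s" "i < D \<alpha>" "j < D \<beta>"
  shows "diag_block_mat (map F [0..<s]) $$ ((\<Sum>\<gamma><\<alpha>. D \<gamma>) + i, (\<Sum>\<gamma><\<beta>. D \<gamma>) + j)
    = (if \<alpha> = \<beta> then F \<alpha> $$ (i, j) else 0)"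
  using assms
proof (induction s)
  case (Suc s)
  let ?A = "diag_block_mat (map F [0..<s])"
  have A: "?A \<in> carrier_mat (\<Sum>\<gamma><s. D \<gamma>) (\<Sum>\<gamma><s. D \<gamma>)"
    using Suc.prems by (intro diag_block_mat_map_carrier) auto
  have F: "F s \<in> carrier_mat (D s) (D s)" using Suc.prems by auto
  have \<alpha>: "\<alpha> < s \<Longrightarrow> (\<Sum>\<gamma><\<alpha>. D \<gamma>) + i < (\<Sum>\<gamma><s. D \<gamma>)" "\<alpha> < s \<or> \<alpha> = s"
    and \<beta>: "\<beta> < s \<Longrightarrow> (\<Sum>\<gamma><\<beta>. D \<gamma>) + j < (\<Sum>\<gamma><s. D \<gamma>)" "\<beta> < s \<or> \<beta> = s"
    using Suc.prems sum_block_position_less[of \<alpha> s i D] sum_block_position_less[of \<beta> s j D]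
    by auto
  have eq: "diag_block_mat (map F [0..<Suc s]) = four_block_mat ?A
      (0\<^sub>m (dim_row ?A) (dim_col (F s))) (0\<^sub>m (dim_row (F s)) (dim_col ?A)) (F s)"
    by (simp add: diag_block_mat_last Let_def)
  show ?case
    unfolding eq using \<alpha>(2) \<beta>(2) \<alpha>(1) \<beta>(1) Suc.prems(4,5) Suc.IH[OF Suc.prems(1)]
    by (elim disjE) (auto simp: carrier_matD[OF A] carrier_matD[OF F])
qed simp

lemma mult_add_less_mult:
  fixes t j m d :: nat
  assumes "t < m" "j < d"
  shows "t * d + j < m * d"
proof -
  have "t * d + j < Suc t * d" using assms by simp
  also have "\<dots> \<le> m * d" using assms by (intro mult_le_mono1) simp
  finally show ?thesis .
qed

lemma kronecker_one_carrier:
  assumes "Y \<in> carrier_mat d d"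
  shows "kronecker (1\<^sub>m m) Y \<in> carrier_mat (m * d) (m * d)"
  using assms by (auto simp: kronecker_def)

lemma kronecker_one_index:
  assumes "Y \<in> carrier_mat d d" "t < m" "u < m" "j < d" "k < d"
  shows "kronecker (1\<^sub>m m) Y $$ (t * d + j, u * d + k) = (if t = u then Y $$ (j, k) else 0)"
proof -
  have "t * d + j < m * d" "u * d + k < m * d" using assms by (auto intro: mult_add_less_mult)
  moreover have "(t * d + j) div d = t" "(t * d + j) mod d = j"
    "(u * d + k) div d = u" "(u * d + k) mod d = k"
    using assms by simp_all
  ultimately show ?thesis using assms by (simp add: kronecker_def)
qed

section \<open>Labelled coordinates of a block-diagonal matrix with multiplicities\<close>

locale multiplicity_blocks =
  fixes s :: nat and m d :: "nat \<Rightarrow> nat"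
begin

definition labels :: "(nat \<times> nat \<times> nat) set" where
  "labels = (SIGMA \<alpha>:{..<s}. {..<m \<alpha>} \<times> {..<d \<alpha>})"

text \<open>\<open>position (\<alpha>, t, j)\<close> is the coordinate of the \<open>j\<close>-th basis vector in the \<open>t\<close>-th copy of the
  \<open>\<alpha>\<close>-th block.\<close>

definition position :: "nat \<times> nat \<times> nat \<Rightarrow> nat" where
  "position = (\<lambda>(\<alpha>, t, j). (\<Sum>\<gamma><\<alpha>. m \<gamma> * d \<gamma>) + (t * d \<alpha> + j))"

abbreviation total :: nat where "total \<equiv> (\<Sum>\<gamma><s. m \<gamma> * d \<gamma>)"

lemma mem_labels: "(\<alpha>, t, j) \<in> labels \<longleftrightarrow> \<alpha> < s \<and> t < m \<alpha> \<and> j < d \<alpha>"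
  by (auto simp: labels_def)

lemma finite_labels: "finite labels"
  by (simp add: labels_def)

lemma position_less_total:
  assumes "p \<in> labels"
  shows "position p < total"
proof -
  obtain \<alpha> t j where p: "p = (\<alpha>, t, j)" by (cases p)
  then have lt: "\<alpha> < s" "t < m \<alpha>" "j < d \<alpha>" using assms by (auto simp: mem_labels)
  show ?thesis
    using sum_block_position_less[of \<alpha> s "t * d \<alpha> + j" "\<lambda>\<gamma>. m \<gamma> * d \<gamma>"] lt
      mult_add_less_mult[OF lt(2,3)]
    by (simp add: p position_def)
qed

text \<open>Positions in an earlier block precede all positions in a later one; within a block,
  division and remainder by \<open>d \<alpha>\<close> recover the copy and the index.\<close>

lemma inj_on_position: "inj_on position labels"
proof (rule inj_onI)
  fix p q assume pq: "p \<in> labels" "q \<in> labels" and eq: "position p = position q"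
  obtain \<alpha> t j \<beta> u k where p: "p = (\<alpha>, t, j)" and q: "q = (\<beta>, u, k)"
    by (cases p, cases q)
  have less: "position (\<alpha>, t, j) < position (\<beta>, u, k)"
    if "(\<alpha>, t, j) \<in> labels" "(\<beta>, u, k) \<in> labels" "\<alpha> < \<beta>" for \<alpha> t j \<beta> u k
    using sum_block_position_less[of \<alpha> \<beta> "t * d \<alpha> + j" "\<lambda>\<gamma>. m \<gamma> * d \<gamma>"]
      mult_add_less_mult[of t "m \<alpha>" j "d \<alpha>"] that
    by (simp add: position_def mem_labels)
  have "\<not> \<alpha> < \<beta>" "\<not> \<beta> < \<alpha>"
    using less[of \<alpha> t j \<beta> u k] less[of \<beta> u k \<alpha> t j] pq eq p q by auto
  then have \<alpha>: "\<alpha> = \<beta>" by simp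
  then have tj: "t * d \<alpha> + j = u * d \<alpha> + k" and jk: "j < d \<alpha>" "k < d \<alpha>"
    using eq pq by (auto simp: p q position_def mem_labels)
  have "t = (t * d \<alpha> + j) div d \<alpha>" "u = (u * d \<alpha> + k) div d \<alpha>"
    "j = (t * d \<alpha> + j) mod d \<alpha>" "k = (u * d \<alpha> + k) mod d \<alpha>"
    using jk by auto
  then show "p = q" using \<alpha> tj p q by simp
qed

text \<open>Surjectivity comes from counting: there are exactly \<open>total\<close> labels and
  \<open>position\<close> is injective into \<open>{..<total}\<close>. No explicit decoding of a
  coordinate is required.\<close>

lemma bij_betw_position: "bij_betw position labels {..<total}"
proof -
  have "card labels = total"
    by (simp add: labels_def card_SigmaI)
  moreover have "position ` labels \<subseteq> {..<total}" using position_less_total by auto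
  ultimately have "position ` labels = {..<total}"
    using card_image[OF inj_on_position] by (intro card_subset_eq) auto
  then show ?thesis using inj_on_position by (simp add: bij_betw_def)
qed

lemma position_cases:
  assumes "x < total"
  obtains \<alpha> t j where "x = position (\<alpha>, t, j)" "(\<alpha>, t, j) \<in> labels"
proof -
  have "x \<in> position ` labels"
    using assms by (simp add: bij_betw_imp_surj_on[OF bij_betw_position])
  then obtain p where "p \<in> labels" "x = position p" by blast
  then show thesis using that by (cases p) blast
qed

lemma position_eq_iff:
  assumes "p \<in> labels" "q \<in> labels"
  shows "position p = position q \<longleftrightarrow> p = q"
  using assms inj_on_position by (auto dest: inj_onD)

text \<open>Used for products with \<open>blocks F\<close>: a row or column of that matrix is
  supported in one copy of one block, so the sum over all coordinates shrinks to a product of size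
  \<open>d \<beta>\<close>.\<close>

lemma sum_total_block:
  fixes h :: "nat \<Rightarrow> complex"
  assumes "\<beta> < s" "u < m \<beta>"
    and zero: "\<And>\<gamma> v l. (\<gamma>, v, l) \<in> labels \<Longrightarrow> (\<gamma>, v) \<noteq> (\<beta>, u) \<Longrightarrow> h (position (\<gamma>, v, l)) = 0"
  shows "(\<Sum>x<total. h x) = (\<Sum>l<d \<beta>. h (position (\<beta>, u, l)))"
proof -
  have "(\<Sum>x<total. h x) = (\<Sum>p\<in>labels. h (position p))"
    by (rule sum.reindex_bij_betw[OF bij_betw_position, symmetric])
  also have "\<dots> = (\<Sum>p\<in>(\<lambda>l. (\<beta>, u, l)) ` {..<d \<beta>}. h (position p))"
  proof (intro sum.mono_neutral_right finite_labels ballI)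
    fix p assume "p \<in> labels - (\<lambda>l. (\<beta>, u, l)) ` {..<d \<beta>}"
    then show "h (position p) = 0"
      using zero[of "fst p" "fst (snd p)" "snd (snd p)"]
      by (cases p) (auto simp: mem_labels)
  qed (use assms in \<open>auto simp: mem_labels\<close>)
  also have "\<dots> = (\<Sum>l<d \<beta>. h (position (\<beta>, u, l)))"
    by (subst sum.reindex) (auto simp: inj_on_def)
  finally show ?thesis .
qed

definition blocks :: "(nat \<Rightarrow> complex mat) \<Rightarrow> complex mat" where
  "blocks F = diag_block_mat (map (\<lambda>\<alpha>. kronecker (1\<^sub>m (m \<alpha>)) (F \<alpha>)) [0..<s])"

lemma blocks_carrier:
  assumes "\<And>\<alpha>. \<alpha> < s \<Longrightarrow> F \<alpha> \<in> carrier_mat (d \<alpha>) (d \<alpha>)"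
  shows "blocks F \<in> carrier_mat total total"
  unfolding blocks_def
  by (intro diag_block_mat_map_carrier kronecker_one_carrier assms)

lemma blocks_index:
  assumes F: "\<And>\<alpha>. \<alpha> < s \<Longrightarrow> F \<alpha> \<in> carrier_mat (d \<alpha>) (d \<alpha>)"
    and "(\<alpha>, t, j) \<in> labels" "(\<beta>, u, k) \<in> labels"
  shows "blocks F $$ (position (\<alpha>, t, j), position (\<beta>, u, k))
    = (if \<alpha> = \<beta> \<and> t = u then F \<alpha> $$ (j, k) else 0)"
proof -
  have "blocks F $$ (position (\<alpha>, t, j), position (\<beta>, u, k))
      = (if \<alpha> = \<beta> then kronecker (1\<^sub>m (m \<alpha>)) (F \<alpha>) $$ (t * d \<alpha> + j, u * d \<beta> + k) else 0)"
    using assms kronecker_one_carrier mult_add_less_mult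
    unfolding blocks_def position_def prod.case
    by (intro diag_block_mat_map_index) (auto simp: mem_labels)
  also have "\<dots> = (if \<alpha> = \<beta> \<and> t = u then F \<alpha> $$ (j, k) else 0)"
    using assms kronecker_one_index[OF F, of \<alpha> t "m \<alpha>" u j k] by (auto simp: mem_labels)
  finally show ?thesis .
qed

lemma mult_blocks_index:
  assumes F: "\<And>\<alpha>. \<alpha> < s \<Longrightarrow> F \<alpha> \<in> carrier_mat (d \<alpha>) (d \<alpha>)"
    and X: "X \<in> carrier_mat total total" and x: "x < total" and p: "(\<beta>, u, k) \<in> labels"
  shows "(X * blocks F) $$ (x, position (\<beta>, u, k))
    = (\<Sum>l<d \<beta>. X $$ (x, position (\<beta>, u, l)) * F \<beta> $$ (l, k))"
proof -
  have B: "blocks F \<in> carrier_mat total total" using F by (rule blocks_carrier)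
  have "(X * blocks F) $$ (x, position (\<beta>, u, k))
      = (\<Sum>y<total. X $$ (x, y) * blocks F $$ (y, position (\<beta>, u, k)))"
    using X B x position_less_total[OF p] by (simp add: scalar_prod_def lessThan_atLeast0)
  also have "\<dots> = (\<Sum>l<d \<beta>. X $$ (x, position (\<beta>, u, l))
      * blocks F $$ (position (\<beta>, u, l), position (\<beta>, u, k)))"
    using p by (intro sum_total_block) (auto simp: blocks_index[OF F] mem_labels)
  also have "\<dots> = (\<Sum>l<d \<beta>. X $$ (x, position (\<beta>, u, l)) * F \<beta> $$ (l, k))"
    using p by (intro sum.cong refl) (simp add: blocks_index[OF F] mem_labels)
  finally show ?thesis .
qed

lemma blocks_mult_index:
  assumes F: "\<And>\<alpha>. \<alpha> < s \<Longrightarrow> F \<alpha> \<in> carrier_mat (d \<alpha>) (d \<alpha>)"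
    and X: "X \<in> carrier_mat total total" and x: "x < total" and p: "(\<alpha>, t, j) \<in> labels"
  shows "(blocks F * X) $$ (position (\<alpha>, t, j), x)
    = (\<Sum>l<d \<alpha>. F \<alpha> $$ (j, l) * X $$ (position (\<alpha>, t, l), x))"
proof -
  have B: "blocks F \<in> carrier_mat total total" using F by (rule blocks_carrier)
  have "(blocks F * X) $$ (position (\<alpha>, t, j), x)
      = (\<Sum>y<total. blocks F $$ (position (\<alpha>, t, j), y) * X $$ (y, x))"
    using X B x position_less_total[OF p] by (simp add: scalar_prod_def lessThan_atLeast0)
  also have "\<dots> = (\<Sum>l<d \<alpha>. blocks F $$ (position (\<alpha>, t, j), position (\<alpha>, t, l))
      * X $$ (position (\<alpha>, t, l), x))"
    using p by (intro sum_total_block) (auto simp: blocks_index[OF F] mem_labels)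
  also have "\<dots> = (\<Sum>l<d \<alpha>. F \<alpha> $$ (j, l) * X $$ (position (\<alpha>, t, l), x))"
    using p by (intro sum.cong refl) (simp add: blocks_index[OF F] mem_labels)
  finally show ?thesis .
qed

section \<open>Matrix units commuting with the blocks\<close>

definition unit_labels :: "(nat \<times> nat \<times> nat) set" where
  "unit_labels = (SIGMA \<alpha>:{..<s}. {..<m \<alpha>} \<times> {..<m \<alpha>})"

text \<open>The matrix unit \<open>|t\<rangle>\<langle>u| \<otimes> 1\<close> of the \<open>\<alpha>\<close>-th block.\<close>

definition block_unit :: "nat \<times> nat \<times> nat \<Rightarrow> complex mat" where
  "block_unit = (\<lambda>(\<alpha>, t, u). mat total total (\<lambda>(x, y).
     if \<exists>j<d \<alpha>. x = position (\<alpha>, t, j) \<and> y = position (\<alpha>, u, j) then 1 else 0))"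

lemma mem_unit_labels: "(\<alpha>, t, u) \<in> unit_labels \<longleftrightarrow> \<alpha> < s \<and> t < m \<alpha> \<and> u < m \<alpha>"
  by (auto simp: unit_labels_def)

lemma finite_unit_labels: "finite unit_labels"
  by (simp add: unit_labels_def)

lemma card_unit_labels: "card unit_labels = (\<Sum>\<alpha><s. (m \<alpha>)\<^sup>2)"
  by (simp add: unit_labels_def card_SigmaI power2_eq_square)

lemma block_unit_carrier: "block_unit i \<in> carrier_mat total total"
  by (cases i) (simp add: block_unit_def)

lemma block_unit_index:
  assumes i: "(\<alpha>, t, u) \<in> unit_labels"
    and p: "(\<beta>, v, j) \<in> labels" and q: "(\<gamma>, w, k) \<in> labels"
  shows "block_unit (\<alpha>, t, u) $$ (position (\<beta>, v, j), position (\<gamma>, w, k))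
    = (if \<beta> = \<alpha> \<and> \<gamma> = \<alpha> \<and> v = t \<and> w = u \<and> j = k then 1 else 0)"
proof -
  have "(\<exists>l<d \<alpha>. position (\<beta>, v, j) = position (\<alpha>, t, l) \<and> position (\<gamma>, w, k) = position (\<alpha>, u, l))
      \<longleftrightarrow> (\<exists>l<d \<alpha>. (\<beta>, v, j) = (\<alpha>, t, l) \<and> (\<gamma>, w, k) = (\<alpha>, u, l))"
    using i p q by (auto simp: position_eq_iff mem_labels mem_unit_labels)
  also have "\<dots> \<longleftrightarrow> \<beta> = \<alpha> \<and> \<gamma> = \<alpha> \<and> v = t \<and> w = u \<and> j = k"
    using p q by (auto simp: mem_labels)
  finally show ?thesis
    using position_less_total[OF p] position_less_total[OF q] by (simp add: block_unit_def)
qed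

text \<open>On block \<alpha>, both products are |t><u| \<otimes> F, because the two tensor factors
  are acted on separately.\<close>

lemma block_unit_commute:
  assumes F: "\<And>\<alpha>. \<alpha> < s \<Longrightarrow> F \<alpha> \<in> carrier_mat (d \<alpha>) (d \<alpha>)"
    and i: "i \<in> unit_labels"
  shows "block_unit i * blocks F = blocks F * block_unit i"
proof -
  have B: "blocks F \<in> carrier_mat total total" using F by (rule blocks_carrier)
  note E = block_unit_carrier[of i]
  show ?thesis
  proof (rule eq_matI)
    fix x y assume "x < dim_row (blocks F * block_unit i)" "y < dim_col (blocks F * block_unit i)"
    then have xy: "x < total" "y < total" using B E by auto
    obtain \<beta> v j where x: "x = position (\<beta>, v, j)" "(\<beta>, v, j) \<in> labels"
      using position_cases[OF xy(1)] .
    obtain \<gamma> w k where y: "y = position (\<gamma>, w, k)" "(\<gamma>, w, k) \<in> labels"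
      using position_cases[OF xy(2)] .
    obtain \<alpha> t u where i': "i = (\<alpha>, t, u)" "(\<alpha>, t, u) \<in> unit_labels"
      using i by (cases i) auto
    have "(block_unit i * blocks F) $$ (x, y)
        = (\<Sum>l<d \<gamma>. block_unit i $$ (x, position (\<gamma>, w, l)) * F \<gamma> $$ (l, k))"
      using mult_blocks_index[OF F E xy(1) y(2)] y(1) by simp
    \<comment> \<open>The identity in the second tensor factor leaves only l = j. The resulting
      closed form is then unfolded again with l = k to reach the opposite product.\<close>
    also have "\<dots> = (\<Sum>l<d \<gamma>. if l = j
        then (if \<beta> = \<alpha> \<and> \<gamma> = \<alpha> \<and> v = t \<and> w = u then F \<alpha> $$ (j, k) else 0) else 0)"
      using x(2) y(2) i'(2) unfolding x(1) i'(1)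
      by (intro sum.cong refl) (subst block_unit_index, auto simp: mem_labels)
    also have "\<dots> = (if \<beta> = \<alpha> \<and> \<gamma> = \<alpha> \<and> v = t \<and> w = u then F \<alpha> $$ (j, k) else 0)"
      using x(2) by (auto simp: mem_labels)
    also have "\<dots> = (\<Sum>l<d \<beta>. if l = k
        then (if \<beta> = \<alpha> \<and> \<gamma> = \<alpha> \<and> v = t \<and> w = u then F \<alpha> $$ (j, k) else 0) else 0)"
      using y(2) by (auto simp: mem_labels)
    also have "\<dots> = (\<Sum>l<d \<beta>. F \<beta> $$ (j, l) * block_unit i $$ (position (\<beta>, v, l), y))"
      using x(2) y(2) i'(2) unfolding y(1) i'(1)
      by (intro sum.cong refl) (subst block_unit_index, auto simp: mem_labels)
    also have "\<dots> = (blocks F * block_unit i) $$ (x, y)"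
      using blocks_mult_index[OF F E xy(2) x(2)] x(1) by simp
    finally show "(block_unit i * blocks F) $$ (x, y) = (blocks F * block_unit i) $$ (x, y)" .
  qed (use carrier_matD[OF B] carrier_matD[OF E] in simp_all)
qed

end

section \<open>Dimension of the commutant\<close>

context multiplicity_blocks
begin

text \<open>The piece of \<open>X\<close> between copy u of block \<beta> and copy t of block
  \<alpha> intertwines the two irreducibles. By Schur it vanishes for \<alpha> \<noteq> \<beta> and
  is a scalar otherwise; these scalars are the coefficients.\<close>

lemma commutant_blocks_expand:
  assumes rep: "\<And>\<alpha> g. \<alpha> < s \<Longrightarrow> g \<in> carrier G \<Longrightarrow> \<sigma> \<alpha> g \<in> carrier_mat (d \<alpha>) (d \<alpha>)"
    and irr: "\<And>\<alpha>. \<alpha> < s \<Longrightarrow> irreducible_rep G (d \<alpha>) (\<sigma> \<alpha>)"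
    and ineq: "\<And>\<alpha> \<beta>. \<alpha> < s \<Longrightarrow> \<beta> < s \<Longrightarrow> \<alpha> \<noteq> \<beta> \<Longrightarrow>
      \<not> equivalent_reps G (d \<alpha>) (\<sigma> \<alpha>) (d \<beta>) (\<sigma> \<beta>)"
    and X: "X \<in> carrier_mat total total"
    and comm: "\<And>g. g \<in> carrier G \<Longrightarrow> X * blocks (\<lambda>\<alpha>. \<sigma> \<alpha> g) = blocks (\<lambda>\<alpha>. \<sigma> \<alpha> g) * X"
  shows "\<exists>c. \<forall>x<total. \<forall>y<total.
    X $$ (x, y) = (\<Sum>i\<in>unit_labels. c i * block_unit i $$ (x, y))"
proof -
  define B where "B \<alpha> t \<beta> u
    = mat (d \<alpha>) (d \<beta>) (\<lambda>(j, k). X $$ (position (\<alpha>, t, j), position (\<beta>, u, k)))" for \<alpha> t \<beta> u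
  have B: "B \<alpha> t \<beta> u \<in> carrier_mat (d \<alpha>) (d \<beta>)" for \<alpha> t \<beta> u by (simp add: B_def)
  have inter: "B \<alpha> t \<beta> u * \<sigma> \<beta> g = \<sigma> \<alpha> g * B \<alpha> t \<beta> u"
    if lt: "\<alpha> < s" "\<beta> < s" "t < m \<alpha>" "u < m \<beta>" and g: "g \<in> carrier G" for \<alpha> t \<beta> u g
  proof (rule eq_matI)
    note \<sigma>\<alpha> = rep[OF lt(1) g] and \<sigma>\<beta> = rep[OF lt(2) g]
    fix j k assume "j < dim_row (\<sigma> \<alpha> g * B \<alpha> t \<beta> u)" "k < dim_col (\<sigma> \<alpha> g * B \<alpha> t \<beta> u)"
    then have jk: "j < d \<alpha>" "k < d \<beta>" using \<sigma>\<alpha> B[of \<alpha> t \<beta> u] by auto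
    have p: "(\<alpha>, t, j) \<in> labels" and q: "(\<beta>, u, k) \<in> labels"
      using lt jk by (auto simp: mem_labels)
    have F: "\<gamma> < s \<Longrightarrow> (\<lambda>\<alpha>. \<sigma> \<alpha> g) \<gamma> \<in> carrier_mat (d \<gamma>) (d \<gamma>)" for \<gamma> using rep g by simp
    have "(B \<alpha> t \<beta> u * \<sigma> \<beta> g) $$ (j, k)
        = (\<Sum>l<d \<beta>. X $$ (position (\<alpha>, t, j), position (\<beta>, u, l)) * \<sigma> \<beta> g $$ (l, k))"
      using jk \<sigma>\<beta> by (simp add: B_def scalar_prod_def lessThan_atLeast0)
    also have "\<dots> = (X * blocks (\<lambda>\<alpha>. \<sigma> \<alpha> g)) $$ (position (\<alpha>, t, j), position (\<beta>, u, k))"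
      by (rule mult_blocks_index[OF F X position_less_total[OF p] q, symmetric])
    also have "\<dots> = (blocks (\<lambda>\<alpha>. \<sigma> \<alpha> g) * X) $$ (position (\<alpha>, t, j), position (\<beta>, u, k))"
      by (simp only: comm[OF g])
    also have "\<dots> = (\<Sum>l<d \<alpha>. \<sigma> \<alpha> g $$ (j, l) * X $$ (position (\<alpha>, t, l), position (\<beta>, u, k)))"
      by (rule blocks_mult_index[OF F X position_less_total[OF q] p])
    also have "\<dots> = (\<sigma> \<alpha> g * B \<alpha> t \<beta> u) $$ (j, k)"
      using jk \<sigma>\<alpha> by (simp add: B_def scalar_prod_def lessThan_atLeast0)
    finally show "(B \<alpha> t \<beta> u * \<sigma> \<beta> g) $$ (j, k) = (\<sigma> \<alpha> g * B \<alpha> t \<beta> u) $$ (j, k)" .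
  qed (use rep[OF lt(1) g] rep[OF lt(2) g] B[of \<alpha> t \<beta> u] in auto)
  \<comment> \<open>A scalar block is known from its (0, 0) entry, which exists as soon as the block
    has any entry at all.\<close>
  define c where "c = (\<lambda>(\<alpha>, t, u). X $$ (position (\<alpha>, t, 0), position (\<alpha>, u, 0)))"
  have entry: "X $$ (position (\<alpha>, t, j), position (\<beta>, u, k))
      = (if \<alpha> = \<beta> \<and> j = k then c (\<alpha>, t, u) else 0)"
    if "(\<alpha>, t, j) \<in> labels" "(\<beta>, u, k) \<in> labels" for \<alpha> t j \<beta> u k
  proof -
    have lt: "\<alpha> < s" "\<beta> < s" "t < m \<alpha>" "u < m \<beta>" and jk: "j < d \<alpha>" "k < d \<beta>"
      using that by (auto simp: mem_labels)
    have XB: "X $$ (position (\<alpha>, t, j), position (\<beta>, u, k)) = B \<alpha> t \<beta> u $$ (j, k)"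
      using jk by (simp add: B_def)
    show ?thesis
    proof (cases "\<alpha> = \<beta>")
      case False
      \<comment> \<open>\<open>B \<alpha> t \<beta> u\<close> maps the space of \<beta> to that of
        \<alpha>, hence the swapped order of the facts passed to Schur's lemma.\<close>
      then have "B \<alpha> t \<beta> u = 0\<^sub>m (d \<alpha>) (d \<beta>)"
        using schur_inequivalent[OF rep[OF lt(2)] rep[OF lt(1)] irr[OF lt(2)] irr[OF lt(1)] B
            inter[OF lt] ineq[OF lt(2,1)]] by simp
      then show ?thesis using XB jk False by simp
    next
      case True
      have lt': "\<alpha> < s" "\<alpha> < s" "t < m \<alpha>" "u < m \<alpha>" using lt True by auto
      obtain z where z: "B \<alpha> t \<alpha> u = z \<cdot>\<^sub>m 1\<^sub>m (d \<alpha>)"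
        using schur_scalar[OF rep[OF lt(1)] irr[OF lt(1)] B inter[OF lt']] by blast
      have "c (\<alpha>, t, u) = B \<alpha> t \<alpha> u $$ (0, 0)" using jk by (simp add: B_def c_def)
      also have "\<dots> = z" using z jk by simp
      finally show ?thesis using XB z jk True by simp
    qed
  qed
  show ?thesis
  proof (intro exI[of _ c] allI impI)
    fix x y assume "x < total" "y < total"
    obtain \<alpha> t j where x: "x = position (\<alpha>, t, j)" "(\<alpha>, t, j) \<in> labels"
      using position_cases[OF \<open>x < total\<close>] .
    obtain \<beta> u k where y: "y = position (\<beta>, u, k)" "(\<beta>, u, k) \<in> labels"
      using position_cases[OF \<open>y < total\<close>] .
    \<comment> \<open>At most the term (\<alpha>, t, u) survives. If \<alpha> \<noteq> \<beta> this
      triple may fail to be a unit label, but then the inner conditional is 0 anyway.\<close>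
    have "(\<Sum>i\<in>unit_labels. c i * block_unit i $$ (x, y))
        = (\<Sum>i\<in>unit_labels. if i = (\<alpha>, t, u) then if \<alpha> = \<beta> \<and> j = k then c i else 0 else 0)"
    proof (rule sum.cong[OF refl])
      fix i assume i: "i \<in> unit_labels"
      obtain \<gamma> v w where i': "i = (\<gamma>, v, w)" by (cases i)
      show "c i * block_unit i $$ (x, y)
          = (if i = (\<alpha>, t, u) then if \<alpha> = \<beta> \<and> j = k then c i else 0 else 0)"
        using block_unit_index[OF i[unfolded i'] x(2) y(2)] x(1) y(1) by (auto simp: i')
    qed
    also have "\<dots> = (if \<alpha> = \<beta> \<and> j = k then c (\<alpha>, t, u) else 0)"
      using x(2) y(2) finite_unit_labels by (auto simp: mem_labels mem_unit_labels)
    also have "\<dots> = X $$ (x, y)" using entry[OF x(2) y(2)] x(1) y(1) by simp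
    finally show "X $$ (x, y) = (\<Sum>i\<in>unit_labels. c i * block_unit i $$ (x, y))" by simp
  qed
qed

text \<open>Conjugation by \<open>U\<close> identifies this commutant with that of the block
  matrices, so the conjugated block units \<open>f i\<close> form a basis.\<close>

lemma mat_subspace_dim_commutant:
  assumes U: "unitary_mat total U"
    and \<pi>: "\<And>g. g \<in> carrier G \<Longrightarrow> \<pi> g \<in> carrier_mat total total"
    and rep: "\<And>\<alpha> g. \<alpha> < s \<Longrightarrow> g \<in> carrier G \<Longrightarrow> \<sigma> \<alpha> g \<in> carrier_mat (d \<alpha>) (d \<alpha>)"
    and irr: "\<And>\<alpha>. \<alpha> < s \<Longrightarrow> irreducible_rep G (d \<alpha>) (\<sigma> \<alpha>)"
    and ineq: "\<And>\<alpha> \<beta>. \<alpha> < s \<Longrightarrow> \<beta> < s \<Longrightarrow> \<alpha> \<noteq> \<beta> \<Longrightarrow>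
      \<not> equivalent_reps G (d \<alpha>) (\<sigma> \<alpha>) (d \<beta>) (\<sigma> \<beta>)"
    and decomp: "\<And>g. g \<in> carrier G \<Longrightarrow> U * \<pi> g * mat_adjoint U = blocks (\<lambda>\<alpha>. \<sigma> \<alpha> g)"
  shows "mat_subspace_dim total (commutant total (\<pi> ` carrier G)) = (\<Sum>\<alpha><s. (m \<alpha>)\<^sup>2)"
proof -
  let ?V = "mat_adjoint U" and ?C = "commutant total (\<pi> ` carrier G)"
  note assoc = assoc_mult_mat[of _ total total _ total _ total]
  have Uc: "U \<in> carrier_mat total total" and UV: "U * ?V = 1\<^sub>m total" and VU: "?V * U = 1\<^sub>m total"
    using U by (auto simp: unitary_mat_def)
  have V: "?V \<in> carrier_mat total total" using Uc by (auto simp: mat_adjoint_index)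
  \<comment> \<open>Once \<open>assoc\<close> has nested all products to the right, \<open>U\<close>
    meets its adjoint in front of a further factor; these are the matching cancellation
    rules.\<close>
  have UVX: "U * (?V * X) = X" and VUX: "?V * (U * X) = X"
    if "X \<in> carrier_mat total total" for X
    using that Uc V UV VU by (simp_all flip: assoc)
  have \<pi>_eq: "\<pi> g = ?V * blocks (\<lambda>\<alpha>. \<sigma> \<alpha> g) * U" if g: "g \<in> carrier G" for g
    using \<pi>[OF g] Uc V by (simp add: decomp[OF g, symmetric] assoc VUX VU)
  have W: "blocks (\<lambda>\<alpha>. \<sigma> \<alpha> g) \<in> carrier_mat total total" if "g \<in> carrier G" for g
    using rep that by (intro blocks_carrier) auto
  define f where "f i = ?V * block_unit i * U" for i
  have fc: "f i \<in> carrier_mat total total" for i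
    using Uc V block_unit_carrier[of i] by (simp add: f_def)
  have sub: "submodule class_ring ?C (module_mat TYPE(complex) total total)"
    using \<pi> by (intro submodule_commutant) auto
  have f: "f i \<in> ?C" if i: "i \<in> unit_labels" for i
  proof -
    have "f i * \<pi> g = \<pi> g * f i" if g: "g \<in> carrier G" for g
    proof -
      let ?W = "blocks (\<lambda>\<alpha>. \<sigma> \<alpha> g)"
      note c = W[OF g] Uc V block_unit_carrier[of i]
      have "f i * \<pi> g = ?V * (block_unit i * ?W) * U"
        using c by (simp add: f_def \<pi>_eq[OF g] assoc UVX)
      also have "block_unit i * ?W = ?W * block_unit i"
        using rep g i by (intro block_unit_commute) auto
      also have "?V * (?W * block_unit i) * U = \<pi> g * f i"
        using c by (simp add: f_def \<pi>_eq[OF g] assoc UVX)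
      finally show ?thesis .
    qed
    then show ?thesis using fc by (auto simp: commutant_def)
  qed
  have expand: "\<exists>c. \<forall>k<total. \<forall>l<total. X $$ (k, l) = (\<Sum>i\<in>unit_labels. c i * f i $$ (k, l))"
    if X: "X \<in> ?C" for X
  proof -
    let ?X = "U * X * ?V"
    have Xc: "X \<in> carrier_mat total total" using X by (simp add: commutant_def)
    have X'c: "?X \<in> carrier_mat total total" using Xc Uc V by simp
    have "?X * blocks (\<lambda>\<alpha>. \<sigma> \<alpha> g) = blocks (\<lambda>\<alpha>. \<sigma> \<alpha> g) * ?X" if g: "g \<in> carrier G" for g
    proof -
      note c = \<pi>[OF g] Uc V Xc
      have "?X * blocks (\<lambda>\<alpha>. \<sigma> \<alpha> g) = U * (X * \<pi> g) * ?V"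
        using c by (simp add: decomp[OF g, symmetric] assoc VUX)
      also have "X * \<pi> g = \<pi> g * X" using X g by (simp add: commutant_def)
      also have "U * (\<pi> g * X) * ?V = blocks (\<lambda>\<alpha>. \<sigma> \<alpha> g) * ?X"
        using c by (simp add: decomp[OF g, symmetric] assoc VUX)
      finally show ?thesis .
    qed
    from commutant_blocks_expand[OF rep irr ineq X'c this] obtain c where
      c: "\<And>x y. x < total \<Longrightarrow> y < total \<Longrightarrow>
        ?X $$ (x, y) = (\<Sum>i\<in>unit_labels. c i * block_unit i $$ (x, y))"
      by blast
    have X_eq: "X = ?V * ?X * U" using Xc Uc V by (simp add: assoc VUX VU)
    show ?thesis
    proof (intro exI[of _ c] allI impI)
      fix k l assume kl: "k < total" "l < total"
      \<comment> \<open>\<open>X\<close> occurs on both sides of \<open>X_eq\<close>, so the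
        equation is applied once by congruence instead of as a rewrite rule.\<close>
      have "X $$ (k, l) = (?V * ?X * U) $$ (k, l)"
        by (rule arg_cong[OF X_eq, where f = "\<lambda>Z. Z $$ (k, l)"])
      also have "\<dots> = (\<Sum>i\<in>unit_labels. c i * f i $$ (k, l))"
        unfolding f_def using c block_unit_carrier kl
        by (intro triple_mult_sum_index[OF V X'c Uc]) auto
      finally show "X $$ (k, l) = (\<Sum>i\<in>unit_labels. c i * f i $$ (k, l))" .
    qed
  qed
  \<comment> \<open>Pairing with \<open>Y (\<alpha>, t, u)\<close> computes the entry of U Z U^* in
    row \<open>position (\<alpha>, t, 0)\<close> and column
    \<open>position (\<alpha>, u, 0)\<close>. For Z = \<open>f j\<close> this is an entry of
    \<open>block_unit j\<close>. The index 0 is legitimate because irreducibility gives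
    \<open>d \<alpha> > 0\<close>.\<close>
  define Y :: "nat \<times> nat \<times> nat \<Rightarrow> complex mat" where
    "Y = (\<lambda>(\<alpha>, t, u). mat total total
      (\<lambda>(k, l). U $$ (position (\<alpha>, t, 0), k) * cnj (U $$ (position (\<alpha>, u, 0), l))))"
  have dual: "(\<Sum>k<total. \<Sum>l<total. Y i $$ (k, l) * f j $$ (k, l)) = (if i = j then 1 else 0)"
    if i: "i \<in> unit_labels" and j: "j \<in> unit_labels" for i j
  proof -
    obtain \<alpha> t u where i': "i = (\<alpha>, t, u)" by (cases i)
    obtain \<beta> v w where j': "j = (\<beta>, v, w)" by (cases j)
    have "d \<alpha> > 0" using irr i by (auto simp: i' mem_unit_labels irreducible_rep_def)
    then have p: "(\<alpha>, t, 0) \<in> labels" and q: "(\<alpha>, u, 0) \<in> labels"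
      using i by (auto simp: i' mem_unit_labels mem_labels)
    have "(\<Sum>k<total. \<Sum>l<total. Y i $$ (k, l) * f j $$ (k, l))
        = (\<Sum>l<total. \<Sum>k<total. U $$ (position (\<alpha>, t, 0), k) * f j $$ (k, l)
            * cnj (U $$ (position (\<alpha>, u, 0), l)))"
      by (subst sum.swap) (simp add: Y_def i' mult_ac)
    also have "\<dots> = (U * f j * ?V) $$ (position (\<alpha>, t, 0), position (\<alpha>, u, 0))"
      by (rule sandwich_index[OF Uc fc Uc position_less_total[OF p] position_less_total[OF q],
            symmetric])
    also have "U * f j * ?V = block_unit j"
      using Uc V block_unit_carrier[of j] by (simp add: f_def assoc UVX UV)
    also have "block_unit j $$ (position (\<alpha>, t, 0), position (\<alpha>, u, 0)) = (if i = j then 1 else 0)"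
      using block_unit_index[OF j[unfolded j'] p q] by (auto simp: i' j')
    finally show ?thesis .
  qed
  show ?thesis
    using mat_subspace_dim_eqI[OF sub finite_unit_labels f expand dual] card_unit_labels by simp
qed

end

subsection \<open>Haar measure and the twirl\<close>

lemma continuous_map_mult_normed_algebra:
  fixes f h :: "'a \<Rightarrow> 'b::real_normed_algebra"
  assumes "continuous_map X euclidean f" "continuous_map X euclidean h"
  shows "continuous_map X euclidean (\<lambda>x. f x * h x)"
  using assms by (simp add: continuous_map_atin tendsto_mult)

lemma haar_borel_measurable:
  assumes G: "compact_group G T" and M: "normalized_haar_measure G T M"
    and f: "continuous_map T euclidean f"
  shows "f \<in> borel_measurable M"
proof (rule borel_measurableI)
  fix S :: "'b set" assume "open S"
  then have "openin T {x \<in> topspace T. f x \<in> S}"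
    using f by (auto simp: continuous_map_def)
  moreover have "f -` S \<inter> space M = {x \<in> topspace T. f x \<in> S}"
    using G M by (auto simp: compact_group_def normalized_haar_measure_def)
  ultimately show "f -` S \<inter> space M \<in> sets M"
    using M by (auto simp: normalized_haar_measure_def intro: sigma_sets.Basic)
qed

text \<open>A continuous function on a compact group is bounded, and the measure is finite.\<close>

lemma haar_integrable:
  fixes f :: "'g \<Rightarrow> complex"
  assumes G: "compact_group G T" and M: "normalized_haar_measure G T M"
    and f: "continuous_map T euclidean f"
  shows "integrable M f"
proof -
  interpret prob_space M using M by (simp add: normalized_haar_measure_def)
  have "compactin T (topspace T)"
    using G unfolding compact_group_def compact_space_def by blast
  then have "compact (f ` topspace T)"
    using image_compactin[OF _ f] by simp
  then obtain B where "\<forall>y \<in> f ` topspace T. norm y \<le> B"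
    using compact_imp_bounded bounded_iff by metis
  then have "\<forall>x \<in> space M. norm (f x) \<le> B"
    using G M by (auto simp: compact_group_def normalized_haar_measure_def)
  then show ?thesis
    by (intro integrable_const_bound[of _ B] AE_I2 haar_borel_measurable[OF G M f]) auto
qed

text \<open>Left translation is continuous, being multiplication restricted to a slice of the
  product; measurability is then checked on the generating open sets.\<close>

lemma haar_translation_measurable:
  assumes G: "compact_group G T" and M: "normalized_haar_measure G T M" and h: "h \<in> carrier G"
  shows "(\<lambda>g. h \<otimes>\<^bsub>G\<^esub> g) \<in> measurable M M"
proof -
  have grp: "group G" and top: "topspace T = carrier G"
    and cont: "continuous_map (prod_topology T T) T (\<lambda>(x, y). x \<otimes>\<^bsub>G\<^esub> y)"
    using G by (auto simp: compact_group_def)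
  interpret group G by (rule grp)
  have sp: "space M = carrier G" and sets: "sets M = sigma_sets (carrier G) {V. openin T V}"
    using M by (auto simp: normalized_haar_measure_def)
  have "continuous_map T (prod_topology T T) (\<lambda>g. (h, g))"
    using h top by (intro continuous_map_pairedI) auto
  from continuous_map_compose[OF this cont]
  have ct: "continuous_map T T (\<lambda>g. h \<otimes>\<^bsub>G\<^esub> g)" by (simp add: o_def)
  show ?thesis
  proof (rule measurable_sigma_sets[OF sets])
    show "{V. openin T V} \<subseteq> Pow (carrier G)"
      using top openin_subset by fastforce
    show "(\<lambda>g. h \<otimes>\<^bsub>G\<^esub> g) \<in> space M \<rightarrow> carrier G" using h sp by auto
    fix V assume "V \<in> {V. openin T V}"
    then have "openin T {g \<in> topspace T. h \<otimes>\<^bsub>G\<^esub> g \<in> V}"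
      using ct by (auto simp: continuous_map_def)
    moreover have "(\<lambda>g. h \<otimes>\<^bsub>G\<^esub> g) -` V \<inter> space M = {g \<in> topspace T. h \<otimes>\<^bsub>G\<^esub> g \<in> V}"
      using sp top by auto
    ultimately show "(\<lambda>g. h \<otimes>\<^bsub>G\<^esub> g) -` V \<inter> space M \<in> sets M"
      using sets by (auto intro: sigma_sets.Basic)
  qed
qed

text \<open>The preimage of \<open>B\<close> under translation by h is the coset of \<open>B\<close>
  by the inverse of h. Invariance thus says that the measure equals its own image under
  translation.\<close>

lemma haar_integral_translate:
  fixes f :: "'g \<Rightarrow> complex"
  assumes G: "compact_group G T" and M: "normalized_haar_measure G T M" and h: "h \<in> carrier G"
    and f: "continuous_map T euclidean f"
  shows "(\<integral>g. f (h \<otimes>\<^bsub>G\<^esub> g) \<partial>M) = (\<integral>g. f g \<partial>M)"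
proof -
  interpret group G using G by (simp add: compact_group_def)
  note tr = haar_translation_measurable[OF G M h]
  have sp: "space M = carrier G"
    and inv: "\<And>g B. g \<in> carrier G \<Longrightarrow> B \<in> sets M \<Longrightarrow> emeasure M (g <#\<^bsub>G\<^esub> B) = emeasure M B"
    using M by (auto simp: normalized_haar_measure_def)
  have "distr M M (\<lambda>g. h \<otimes>\<^bsub>G\<^esub> g) = M"
  proof (rule measure_eqI)
    fix B assume "B \<in> sets (distr M M (\<lambda>g. h \<otimes>\<^bsub>G\<^esub> g))"
    then have B: "B \<in> sets M" by simp
    have Bc: "B \<subseteq> carrier G" using sets.sets_into_space[OF B] sp by simp
    have "(\<lambda>g. h \<otimes>\<^bsub>G\<^esub> g) -` B \<inter> space M = inv\<^bsub>G\<^esub> h <#\<^bsub>G\<^esub> B"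
    proof
      show "(\<lambda>g. h \<otimes>\<^bsub>G\<^esub> g) -` B \<inter> space M \<subseteq> inv\<^bsub>G\<^esub> h <#\<^bsub>G\<^esub> B"
      proof
        fix g assume "g \<in> (\<lambda>g. h \<otimes>\<^bsub>G\<^esub> g) -` B \<inter> space M"
        then have "h \<otimes>\<^bsub>G\<^esub> g \<in> B" "g \<in> carrier G" using sp by auto
        moreover from this have "g = inv\<^bsub>G\<^esub> h \<otimes>\<^bsub>G\<^esub> (h \<otimes>\<^bsub>G\<^esub> g)"
          using h by (simp add: m_assoc[symmetric])
        ultimately show "g \<in> inv\<^bsub>G\<^esub> h <#\<^bsub>G\<^esub> B" by (auto simp: l_coset_def)
      qed
      show "inv\<^bsub>G\<^esub> h <#\<^bsub>G\<^esub> B \<subseteq> (\<lambda>g. h \<otimes>\<^bsub>G\<^esub> g) -` B \<inter> space M"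
        using Bc h sp by (auto simp: l_coset_def m_assoc[symmetric] subset_iff)
    qed
    then show "emeasure (distr M M (\<lambda>g. h \<otimes>\<^bsub>G\<^esub> g)) B = emeasure M B"
      using inv[of "inv\<^bsub>G\<^esub> h" B] h B by (simp add: emeasure_distr[OF tr B])
  qed simp
  then have "(\<integral>g. f g \<partial>M) = (\<integral>g. f g \<partial>distr M M (\<lambda>g. h \<otimes>\<^bsub>G\<^esub> g))" by simp
  also have "\<dots> = (\<integral>g. f (h \<otimes>\<^bsub>G\<^esub> g) \<partial>M)"
    by (rule integral_distr[OF tr haar_borel_measurable[OF G M f]])
  finally show ?thesis by simp
qed

section \<open>The twirl, its range and its trace dual\<close>

locale twirled_rep =
  fixes G :: "'g monoid" and T :: "'g topology" and M :: "'g measure"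
    and n :: nat and \<pi> :: "'g \<Rightarrow> complex mat"
  assumes G: "compact_group G T" and M: "normalized_haar_measure G T M"
    and rep: "unitary_rep G T n \<pi>"
begin

sublocale group G using G by (simp add: compact_group_def)

sublocale prob_space M using M by (simp add: normalized_haar_measure_def)

lemma space_M: "space M = carrier G"
  using M by (simp add: normalized_haar_measure_def)

lemma rep_carrier: "g \<in> carrier G \<Longrightarrow> \<pi> g \<in> carrier_mat n n"
  using rep by (simp add: unitary_rep_def unitary_mat_def)

lemma rep_mult: "g \<in> carrier G \<Longrightarrow> h \<in> carrier G \<Longrightarrow> \<pi> (g \<otimes>\<^bsub>G\<^esub> h) = \<pi> g * \<pi> h"
  using rep by (simp add: unitary_rep_def)

text \<open>The image of the unit is idempotent by multiplicativity, and an idempotent unitary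
  matrix is the identity.\<close>

lemma rep_one: "\<pi> \<one>\<^bsub>G\<^esub> = 1\<^sub>m n"
proof -
  let ?P = "\<pi> \<one>\<^bsub>G\<^esub>"
  have P: "?P \<in> carrier_mat n n" and adj: "mat_adjoint ?P * ?P = 1\<^sub>m n"
    using rep by (auto simp: unitary_rep_def unitary_mat_def)
  have A: "mat_adjoint ?P \<in> carrier_mat n n" using P by (auto simp: mat_adjoint_index)
  have "mat_adjoint ?P * (?P * ?P) = 1\<^sub>m n * ?P"
    using assoc_mult_mat[OF A P P] adj by simp
  then show ?thesis using rep_mult[of "\<one>\<^bsub>G\<^esub>" "\<one>\<^bsub>G\<^esub>"] adj P by simp
qed

lemma rep_inv:
  assumes "g \<in> carrier G"
  shows "\<pi> g * \<pi> (inv\<^bsub>G\<^esub> g) = 1\<^sub>m n" "\<pi> (inv\<^bsub>G\<^esub> g) * \<pi> g = 1\<^sub>m n"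
  using rep_mult[of g "inv\<^bsub>G\<^esub> g"] rep_mult[of "inv\<^bsub>G\<^esub> g" g] assms rep_one by auto

definition conjugated :: "complex mat \<Rightarrow> 'g \<Rightarrow> complex mat" where
  "conjugated \<rho> g = \<pi> g * \<rho> * \<pi> (inv\<^bsub>G\<^esub> g)"

lemma conjugated_carrier:
  "g \<in> carrier G \<Longrightarrow> \<rho> \<in> carrier_mat n n \<Longrightarrow> conjugated \<rho> g \<in> carrier_mat n n"
  using rep_carrier[of g] rep_carrier[of "inv\<^bsub>G\<^esub> g"] by (simp add: conjugated_def)

text \<open>Each entry is a polynomial in entries of \<open>\<pi>\<close> at g and at its inverse,
  and inversion is continuous.\<close>

lemma continuous_conjugated:
  assumes \<rho>: "\<rho> \<in> carrier_mat n n" and ij: "i < n" "j < n"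
  shows "continuous_map T euclidean (\<lambda>g. conjugated \<rho> g $$ (i, j))"
proof -
  have top: "topspace T = carrier G" and inv: "continuous_map T T (\<lambda>x. inv\<^bsub>G\<^esub> x)"
    using G by (auto simp: compact_group_def)
  have cont: "continuous_map T euclidean (\<lambda>g. \<pi> g $$ (k, l))" if "k < n" "l < n" for k l
    using rep that by (simp add: unitary_rep_def)
  have cont_inv: "continuous_map T euclidean (\<lambda>g. \<pi> (inv\<^bsub>G\<^esub> g) $$ (k, l))" if "k < n" "l < n" for k l
    using continuous_map_compose[OF inv cont[OF that]] by (simp add: o_def)
  have "continuous_map T euclidean
      (\<lambda>g. \<Sum>l<n. (\<Sum>k<n. \<pi> g $$ (i, k) * \<rho> $$ (k, l)) * \<pi> (inv\<^bsub>G\<^esub> g) $$ (l, j))"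
    using ij by (intro continuous_map_sum continuous_map_mult_normed_algebra cont cont_inv) auto
  then show ?thesis
  proof (rule continuous_map_eq)
    fix g assume "g \<in> topspace T"
    then have "\<pi> g \<in> carrier_mat n n" "\<pi> (inv\<^bsub>G\<^esub> g) \<in> carrier_mat n n"
      using top rep_carrier by auto
    then show "(\<Sum>l<n. (\<Sum>k<n. \<pi> g $$ (i, k) * \<rho> $$ (k, l)) * \<pi> (inv\<^bsub>G\<^esub> g) $$ (l, j))
        = conjugated \<rho> g $$ (i, j)"
      using \<rho> ij by (auto simp: conjugated_def scalar_prod_def lessThan_atLeast0
          simp del: assoc_mult_mat intro!: sum.cong)
  qed
qed

lemma integrable_conjugated:
  "\<rho> \<in> carrier_mat n n \<Longrightarrow> i < n \<Longrightarrow> j < n \<Longrightarrow> integrable M (\<lambda>g. conjugated \<rho> g $$ (i, j))"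
  by (rule haar_integrable[OF G M continuous_conjugated])

abbreviation twirling :: "complex mat \<Rightarrow> complex mat" where "twirling \<equiv> twirl G M n \<pi>"

lemma twirling_carrier: "twirling \<rho> \<in> carrier_mat n n"
  by (simp add: twirl_def)

lemma twirling_index:
  "i < n \<Longrightarrow> j < n \<Longrightarrow> twirling \<rho> $$ (i, j) = (\<integral>g. conjugated \<rho> g $$ (i, j) \<partial>M)"
  by (simp add: twirl_def conjugated_def)

text \<open>The pointwise source of commutation: moving \<open>\<pi> h\<close> across the integrand
  of the twirl only shifts the group variable by h.\<close>

lemma rep_mult_conjugated:
  assumes h: "h \<in> carrier G" and g: "g \<in> carrier G" and \<rho>: "\<rho> \<in> carrier_mat n n"
  shows "\<pi> h * conjugated \<rho> g = conjugated \<rho> (h \<otimes>\<^bsub>G\<^esub> g) * \<pi> h"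
proof -
  note c = rep_carrier[OF h] rep_carrier[OF g] rep_carrier[OF inv_closed[OF g]]
    rep_carrier[OF inv_closed[OF h]]
  have "conjugated \<rho> (h \<otimes>\<^bsub>G\<^esub> g) * \<pi> h
      = \<pi> h * \<pi> g * \<rho> * (\<pi> (inv\<^bsub>G\<^esub> g) * \<pi> (inv\<^bsub>G\<^esub> h)) * \<pi> h"
    using h g by (simp add: conjugated_def rep_mult inv_mult_group)
  also have "\<dots> = \<pi> h * (\<pi> g * \<rho> * \<pi> (inv\<^bsub>G\<^esub> g)) * (\<pi> (inv\<^bsub>G\<^esub> h) * \<pi> h)"
    using c \<rho> by (simp add: assoc_mult_mat[of _ n n _ n _ n])
  also have "\<dots> = \<pi> h * conjugated \<rho> g"
    using c \<rho> by (simp add: rep_inv[OF h] conjugated_def)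
  finally show ?thesis by simp
qed

lemma twirling_in_commutant:
  assumes \<rho>: "\<rho> \<in> carrier_mat n n"
  shows "twirling \<rho> \<in> commutant n (\<pi> ` carrier G)"
proof -
  have "twirling \<rho> * \<pi> h = \<pi> h * twirling \<rho>" if h: "h \<in> carrier G" for h
  proof (rule eq_matI)
    note P = rep_carrier[OF h]
    fix i j assume "i < dim_row (\<pi> h * twirling \<rho>)" "j < dim_col (\<pi> h * twirling \<rho>)"
    then have ij: "i < n" "j < n" using P twirling_carrier[of \<rho>] by auto
    have "(\<pi> h * twirling \<rho>) $$ (i, j) = (\<Sum>k<n. \<pi> h $$ (i, k) * twirling \<rho> $$ (k, j))"
      using ij P twirling_carrier[of \<rho>] by (simp add: scalar_prod_def lessThan_atLeast0)
    also have "\<dots> = (\<integral>g. (\<Sum>k<n. \<pi> h $$ (i, k) * conjugated \<rho> g $$ (k, j)) \<partial>M)"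
      using ij \<rho> by (simp add: twirling_index integrable_conjugated)
    also have "\<dots> = (\<integral>g. (\<Sum>k<n. conjugated \<rho> (h \<otimes>\<^bsub>G\<^esub> g) $$ (i, k) * \<pi> h $$ (k, j)) \<partial>M)"
    proof (rule Bochner_Integration.integral_cong[OF refl])
      fix g assume "g \<in> space M"
      then have g: "g \<in> carrier G" by (simp add: space_M)
      have "(\<pi> h * conjugated \<rho> g) $$ (i, j) = (conjugated \<rho> (h \<otimes>\<^bsub>G\<^esub> g) * \<pi> h) $$ (i, j)"
        using rep_mult_conjugated[OF h g \<rho>] by simp
      then show "(\<Sum>k<n. \<pi> h $$ (i, k) * conjugated \<rho> g $$ (k, j))
          = (\<Sum>k<n. conjugated \<rho> (h \<otimes>\<^bsub>G\<^esub> g) $$ (i, k) * \<pi> h $$ (k, j))"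
        using ij P conjugated_carrier[OF g \<rho>] conjugated_carrier[OF m_closed[OF h g] \<rho>]
        by (simp add: scalar_prod_def lessThan_atLeast0)
    qed
    \<comment> \<open>Left invariance absorbs the shift by h.\<close>
    also have "\<dots> = (\<integral>g. (\<Sum>k<n. conjugated \<rho> g $$ (i, k) * \<pi> h $$ (k, j)) \<partial>M)"
      using ij \<rho>
      by (intro haar_integral_translate[OF G M h] continuous_map_sum
          continuous_map_mult_normed_algebra continuous_conjugated) auto
    also have "\<dots> = (\<Sum>k<n. twirling \<rho> $$ (i, k) * \<pi> h $$ (k, j))"
      using ij \<rho> by (simp add: twirling_index integrable_conjugated)
    also have "\<dots> = (twirling \<rho> * \<pi> h) $$ (i, j)"
      using ij P twirling_carrier[of \<rho>] by (simp add: scalar_prod_def lessThan_atLeast0)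
    finally show "(twirling \<rho> * \<pi> h) $$ (i, j) = (\<pi> h * twirling \<rho>) $$ (i, j)" by simp
  qed (use rep_carrier[OF h] twirling_carrier[of \<rho>] in auto)
  then show ?thesis by (auto simp: commutant_def twirling_carrier)
qed

text \<open>Since \<open>X\<close> commutes with \<open>\<pi> g\<close>, cyclicity of the trace
  cancels \<open>\<pi> g\<close> against its inverse for every g. The integrand is constant and the
  total mass is 1.\<close>

lemma trace_mult_twirling:
  assumes X: "X \<in> commutant n (\<pi> ` carrier G)" and \<rho>: "\<rho> \<in> carrier_mat n n"
  shows "mat_trace (X * twirling \<rho>) = mat_trace (X * \<rho>)"
proof -
  have Xc: "X \<in> carrier_mat n n" using X by (simp add: commutant_def)
  have "mat_trace (X * twirling \<rho>) = (\<Sum>k<n. \<Sum>l<n. X $$ (k, l) * twirling \<rho> $$ (l, k))"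
    by (rule mat_trace_mult[OF Xc twirling_carrier])
  also have "\<dots> = (\<Sum>k<n. \<integral>g. (\<Sum>l<n. X $$ (k, l) * conjugated \<rho> g $$ (l, k)) \<partial>M)"
    using \<rho> by (intro sum.cong refl) (simp add: twirling_index integrable_conjugated)
  also have "\<dots> = (\<integral>g. (\<Sum>k<n. \<Sum>l<n. X $$ (k, l) * conjugated \<rho> g $$ (l, k)) \<partial>M)"
    using \<rho> by (intro Bochner_Integration.integral_sum[symmetric] Bochner_Integration.integrable_sum
        integrable_mult_right integrable_conjugated) auto
  also have "\<dots> = (\<integral>g. mat_trace (X * \<rho>) \<partial>M)"
  proof (rule Bochner_Integration.integral_cong[OF refl])
    fix g assume "g \<in> space M"
    then have g: "g \<in> carrier G" by (simp add: space_M)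
    note P = rep_carrier[OF g] and Q = rep_carrier[OF inv_closed[OF g]]
    have "(\<Sum>k<n. \<Sum>l<n. X $$ (k, l) * conjugated \<rho> g $$ (l, k)) = mat_trace (X * conjugated \<rho> g)"
      by (rule mat_trace_mult[OF Xc conjugated_carrier[OF g \<rho>], symmetric])
    also have "X * conjugated \<rho> g = (X * \<pi> g) * (\<rho> * \<pi> (inv\<^bsub>G\<^esub> g))"
      using P Q Xc \<rho> by (simp add: conjugated_def assoc_mult_mat[of _ n n _ n _ n])
    also have "X * \<pi> g = \<pi> g * X" using X g by (simp add: commutant_def)
    also have "(\<pi> g * X) * (\<rho> * \<pi> (inv\<^bsub>G\<^esub> g)) = \<pi> g * (X * \<rho> * \<pi> (inv\<^bsub>G\<^esub> g))"
      using P Q Xc \<rho> by (simp add: assoc_mult_mat[of _ n n _ n _ n])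
    also have "mat_trace \<dots> = mat_trace ((X * \<rho> * \<pi> (inv\<^bsub>G\<^esub> g)) * \<pi> g)"
      using P Q Xc \<rho> by (intro mat_trace_mult_commute) auto
    also have "(X * \<rho> * \<pi> (inv\<^bsub>G\<^esub> g)) * \<pi> g = X * \<rho> * (\<pi> (inv\<^bsub>G\<^esub> g) * \<pi> g)"
      using P Q Xc \<rho> by (simp add: assoc_mult_mat[of _ n n _ n _ n])
    also have "\<dots> = X * \<rho>" using Xc \<rho> by (simp add: rep_inv[OF g])
    finally show "(\<Sum>k<n. \<Sum>l<n. X $$ (k, l) * conjugated \<rho> g $$ (l, k)) = mat_trace (X * \<rho>)" .
  qed
  also have "\<dots> = mat_trace (X * \<rho>)" using prob_space by simp
  finally show ?thesis .
qed

text \<open>The trace-dual map \<open>\<Psi>\<close> of the twirl fixes the commutant and the twirl maps into it, so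
  \<open>tr (\<Phi> Y \<cdot> \<rho>) = tr (\<Psi> (\<Phi> Y) \<cdot> \<rho>) = tr (\<Phi> Y \<cdot> \<Phi> \<rho>)\<close>; the right-hand side is symmetric in \<open>Y\<close> and
  \<open>\<rho>\<close>, whence \<open>\<Psi> = \<Phi>\<close> with left invariance of the Haar measure alone.\<close>

lemma trace_dual_eq_twirling:
  assumes \<Psi>c: "\<And>X. X \<in> carrier_mat n n \<Longrightarrow> \<Psi> X \<in> carrier_mat n n"
    and dual: "\<And>X \<rho>. X \<in> carrier_mat n n \<Longrightarrow> \<rho> \<in> carrier_mat n n \<Longrightarrow>
      mat_trace (\<Psi> X * \<rho>) = mat_trace (X * twirling \<rho>)"
    and Y: "Y \<in> carrier_mat n n"
  shows "\<Psi> Y = twirling Y"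
proof (rule mat_eq_by_traceI[OF \<Psi>c[OF Y] twirling_carrier])
  fix \<rho> :: "complex mat" assume \<rho>: "\<rho> \<in> carrier_mat n n"
  have "mat_trace (\<Psi> Y * \<rho>) = mat_trace (Y * twirling \<rho>)" by (rule dual[OF Y \<rho>])
  also have "\<dots> = mat_trace (twirling \<rho> * Y)"
    by (rule mat_trace_mult_commute[OF Y twirling_carrier])
  also have "\<dots> = mat_trace (twirling \<rho> * twirling Y)"
    by (rule trace_mult_twirling[OF twirling_in_commutant[OF \<rho>] Y, symmetric])
  also have "\<dots> = mat_trace (twirling Y * twirling \<rho>)"
    by (rule mat_trace_mult_commute[OF twirling_carrier twirling_carrier])
  also have "\<dots> = mat_trace (twirling Y * \<rho>)"
    by (rule trace_mult_twirling[OF twirling_in_commutant[OF Y] \<rho>])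
  finally show "mat_trace (\<Psi> Y * \<rho>) = mat_trace (twirling Y * \<rho>)" .
qed

text \<open>This yields the inclusion of the commutant in the range of \<Psi>: the functional \<rho>
  \<mapsto> tr(X \<rho>) is unchanged by the twirl, and the trace form is nondegenerate.\<close>

lemma trace_dual_fixes_commutant:
  assumes X: "X \<in> commutant n (\<pi> ` carrier G)"
    and \<Psi>c: "\<And>X. X \<in> carrier_mat n n \<Longrightarrow> \<Psi> X \<in> carrier_mat n n"
    and dual: "\<And>X \<rho>. X \<in> carrier_mat n n \<Longrightarrow> \<rho> \<in> carrier_mat n n \<Longrightarrow>
      mat_trace (\<Psi> X * \<rho>) = mat_trace (X * twirling \<rho>)"
  shows "\<Psi> X = X"
proof (rule mat_eq_by_traceI)
  show Xc: "X \<in> carrier_mat n n" using X by (simp add: commutant_def)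
  then show "\<Psi> X \<in> carrier_mat n n" by (rule \<Psi>c)
  show "mat_trace (\<Psi> X * \<rho>) = mat_trace (X * \<rho>)" if "\<rho> \<in> carrier_mat n n" for \<rho>
    using dual[OF Xc that] trace_mult_twirling[OF X that] by simp
qed

end

subsection \<open>The operator system\<close>

text \<open>The Heisenberg picture of the channel with Kraus operators \<open>A i\<close>, that is,
  the map \<Psi>.\<close>

definition kraus_dual ::
    "nat \<Rightarrow> nat \<Rightarrow> (nat \<Rightarrow> complex mat) \<Rightarrow> complex mat \<Rightarrow> complex mat" where
  "kraus_dual n r A X = mat n n (\<lambda>(p, q). \<Sum>i<r. (mat_adjoint (A i) * X * A i) $$ (p, q))"

lemma kraus_dual_carrier: "kraus_dual n r A X \<in> carrier_mat n n"
  by (simp add: kraus_dual_def)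

text \<open>Cyclicity of the trace moves \<open>A i\<close> to the other side in each Kraus term;
  the rest exchanges finite sums.\<close>

lemma trace_kraus_dual:
  assumes kraus: "kraus_rep n n r A \<Phi>"
    and X: "X \<in> carrier_mat n n" and \<rho>: "\<rho> \<in> carrier_mat n n"
  shows "mat_trace (kraus_dual n r A X * \<rho>) = mat_trace (X * \<Phi> \<rho>)"
proof -
  let ?S = "\<lambda>i. A i * \<rho> * mat_adjoint (A i)" and ?D = "\<lambda>i. mat_adjoint (A i) * X * A i"
  have A: "A i \<in> carrier_mat n n" if "i < r" for i using kraus that by (simp add: kraus_rep_def)
  have A': "mat_adjoint (A i) \<in> carrier_mat n n" if "i < r" for i
    using A[OF that] by (auto simp: mat_adjoint_index)
  have S: "?S i \<in> carrier_mat n n" and D: "?D i \<in> carrier_mat n n" if "i < r" for i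
    using A[OF that] A'[OF that] X \<rho> by auto
  have \<Phi>: "\<Phi> \<rho> = finsum (module_mat TYPE(complex) n n) ?S {..<r}"
    using kraus \<rho> by (simp add: kraus_rep_def)
  have \<Phi>c: "\<Phi> \<rho> \<in> carrier_mat n n"
    and \<Phi>_index: "\<And>k l. k < n \<Longrightarrow> l < n \<Longrightarrow> \<Phi> \<rho> $$ (k, l) = (\<Sum>i<r. ?S i $$ (k, l))"
    unfolding \<Phi> using finsum_mat_carrier_index[of "{..<r}" ?S n n] S by auto
  have tr: "(\<Sum>k<n. \<Sum>l<n. \<Sum>i<r. Y i $$ (k, l) * Z i $$ (l, k)) = (\<Sum>i<r. mat_trace (Y i * Z i))"
    if "\<And>i. i < r \<Longrightarrow> Y i \<in> carrier_mat n n" "\<And>i. i < r \<Longrightarrow> Z i \<in> carrier_mat n n"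
    for Y Z :: "nat \<Rightarrow> complex mat"
  proof -
    have "(\<Sum>k<n. \<Sum>l<n. \<Sum>i<r. Y i $$ (k, l) * Z i $$ (l, k))
        = (\<Sum>k<n. \<Sum>i<r. \<Sum>l<n. Y i $$ (k, l) * Z i $$ (l, k))"
      by (rule sum.cong[OF refl], rule sum.swap)
    also have "\<dots> = (\<Sum>i<r. \<Sum>k<n. \<Sum>l<n. Y i $$ (k, l) * Z i $$ (l, k))"
      by (rule sum.swap)
    also have "\<dots> = (\<Sum>i<r. mat_trace (Y i * Z i))"
      using that by (intro sum.cong refl mat_trace_mult[symmetric]) auto
    finally show ?thesis .
  qed
  have "mat_trace (kraus_dual n r A X * \<rho>)
      = (\<Sum>k<n. \<Sum>l<n. \<Sum>i<r. ?D i $$ (k, l) * \<rho> $$ (l, k))"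
    unfolding mat_trace_mult[OF kraus_dual_carrier \<rho>]
    by (intro sum.cong refl) (simp add: kraus_dual_def sum_distrib_right del: assoc_mult_mat)
  also have "\<dots> = (\<Sum>i<r. mat_trace (?D i * \<rho>))"
    using D \<rho> by (intro tr) auto
  also have "\<dots> = (\<Sum>i<r. mat_trace (X * ?S i))"
  proof (rule sum.cong[OF refl])
    fix i assume "i \<in> {..<r}"
    then have c: "A i \<in> carrier_mat n n" "mat_adjoint (A i) \<in> carrier_mat n n" using A A' by auto
    have "?D i * \<rho> = mat_adjoint (A i) * (X * A i * \<rho>)"
      using c X \<rho> by (simp add: assoc_mult_mat[of _ n n _ n _ n])
    also have "mat_trace \<dots> = mat_trace (X * A i * \<rho> * mat_adjoint (A i))"
      using c X \<rho> by (intro mat_trace_mult_commute[of _ n n]) auto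
    also have "X * A i * \<rho> * mat_adjoint (A i) = X * ?S i"
      using c X \<rho> by (simp add: assoc_mult_mat[of _ n n _ n _ n])
    finally show "mat_trace (?D i * \<rho>) = mat_trace (X * ?S i)" .
  qed
  also have "\<dots> = (\<Sum>k<n. \<Sum>l<n. \<Sum>i<r. X $$ (k, l) * ?S i $$ (l, k))"
    using S X by (intro tr[symmetric]) auto
  also have "\<dots> = mat_trace (X * \<Phi> \<rho>)"
    unfolding mat_trace_mult[OF X \<Phi>c]
    by (intro sum.cong refl) (simp add: \<Phi>_index sum_distrib_left del: assoc_mult_mat)
  finally show ?thesis .
qed

text \<open>Row i of R_a is <e_a|A_i, so multiplying by the adjoint of R_b sums A_i^* |e_b><e_a| A_i
  over i. This brings \<Psi> into the operator system.\<close>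

lemma canonical_kraus_product:
  assumes A: "\<forall>i<r. A i \<in> carrier_mat n n" and ea: "e a \<in> carrier_vec n" and eb: "e b \<in> carrier_vec n"
  shows "mat_adjoint (canonical_kraus n r A e b) * canonical_kraus n r A e a
    = kraus_dual n r A (ketbra (e b) (e a))"
proof (rule eq_matI)
  let ?R = "canonical_kraus n r A e" and ?K = "ketbra (e b) (e a)"
  note Ra = canonical_kraus_carrier_index[where e = e, OF A ea]
    and Rb = canonical_kraus_carrier_index[where e = e, OF A eb]
  have K: "?K \<in> carrier_mat n n" using ea eb by (auto simp: ketbra_def)
  fix p q assume "p < dim_row (kraus_dual n r A ?K)" "q < dim_col (kraus_dual n r A ?K)"
  then have pq: "p < n" "q < n" by (auto simp: kraus_dual_def)
  have "(mat_adjoint (?R b) * ?R a) $$ (p, q) = (\<Sum>i<r. cnj (?R b $$ (i, p)) * ?R a $$ (i, q))"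
    using Ra(1) Rb(1) pq by (simp add: scalar_prod_def lessThan_atLeast0 mat_adjoint_index)
  also have "\<dots> = (\<Sum>i<r. (mat_adjoint (A i) * ?K * A i) $$ (p, q))"
  proof (rule sum.cong[OF refl])
    fix i assume "i \<in> {..<r}"
    then have i: "i < r" and Ai: "A i \<in> carrier_mat n n" using A by auto
    have Ai': "mat_adjoint (A i) \<in> carrier_mat n n" using Ai by (auto simp: mat_adjoint_index)
    have "(mat_adjoint (A i) * ?K * A i) $$ (p, q) = (\<Sum>l<n. \<Sum>k<n.
        (e b $ k * cnj (A i $$ (k, p))) * (cnj (e a $ l) * A i $$ (l, q)))"
      unfolding triple_mult_index[OF Ai' K Ai pq]
      by (intro sum.cong refl) (use Ai ea eb pq in \<open>auto simp: ketbra_def mat_adjoint_index mult_ac\<close>)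
    also have "\<dots> = (\<Sum>k<n. e b $ k * cnj (A i $$ (k, p))) * (\<Sum>l<n. cnj (e a $ l) * A i $$ (l, q))"
      by (subst sum.swap) (rule sum_product[symmetric])
    also have "\<dots> = cnj (?R b $$ (i, p)) * ?R a $$ (i, q)"
      using Ra(2)[OF i pq(2)] Rb(2)[OF i pq(1)] by simp
    finally show "cnj (?R b $$ (i, p)) * ?R a $$ (i, q) = (mat_adjoint (A i) * ?K * A i) $$ (p, q)"
      by simp
  qed
  also have "\<dots> = kraus_dual n r A ?K $$ (p, q)" using pq by (simp add: kraus_dual_def)
  finally show "(mat_adjoint (?R b) * ?R a) $$ (p, q) = kraus_dual n r A ?K $$ (p, q)" .
qed (use canonical_kraus_carrier_index(1)[where e = e, OF A ea]
    canonical_kraus_carrier_index(1)[where e = e, OF A eb]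
    in \<open>auto simp: kraus_dual_def mat_adjoint_index\<close>)

section \<open>Expansion in rank-one operators and the operator system\<close>

text \<open>The completeness relation and its complex conjugate: the first expands the row index of
  a matrix, the second its column index.\<close>

lemma orthonormal_basis_expand:
  assumes e: "orthonormal_basis n e" and k: "k < n"
  shows "(\<Sum>b<n. e b $ k * (\<Sum>k'<n. cnj (e b $ k') * h k')) = h k"
    and "(\<Sum>b<n. cnj (e b $ k) * (\<Sum>k'<n. e b $ k' * h k')) = h k"
proof -
  have "(\<Sum>b<n. e b $ k * (\<Sum>k'<n. cnj (e b $ k') * h k'))
      = (\<Sum>k'<n. (\<Sum>b<n. cnj (e b $ k') * e b $ k) * h k')"
    unfolding sum_distrib_left sum_distrib_right by (subst sum.swap) (simp add: mult_ac)
  also have "\<dots> = (\<Sum>k'<n. if k' = k then h k' else 0)"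
    using k by (intro sum.cong refl) (simp add: orthonormal_basis_resolution[OF e])
  finally show "(\<Sum>b<n. e b $ k * (\<Sum>k'<n. cnj (e b $ k') * h k')) = h k" using k by simp
  have "(\<Sum>b<n. cnj (e b $ k) * (\<Sum>k'<n. e b $ k' * h k'))
      = (\<Sum>k'<n. (\<Sum>b<n. cnj (e b $ k) * e b $ k') * h k')"
    unfolding sum_distrib_left sum_distrib_right by (subst sum.swap) (simp add: mult_ac)
  also have "\<dots> = (\<Sum>k'<n. if k = k' then h k' else 0)"
    using k by (intro sum.cong refl) (simp add: orthonormal_basis_resolution[OF e])
  finally show "(\<Sum>b<n. cnj (e b $ k) * (\<Sum>k'<n. e b $ k' * h k')) = h k" using k by simp
qed

lemma ketbra_expand:
  assumes e: "orthonormal_basis n e"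
  obtains c where "\<And>k l. k < n \<Longrightarrow> l < n \<Longrightarrow>
    X $$ (k, l) = (\<Sum>(b, a)\<in>{..<n} \<times> {..<n}. c (b, a) * ketbra (e b) (e a) $$ (k, l))"
proof -
  \<comment> \<open>The coefficient is the matrix element <e_b|X|e_a>.\<close>
  define c where
    "c = (\<lambda>(b, a). \<Sum>l'<n. e a $ l' * (\<Sum>k'<n. cnj (e b $ k') * X $$ (k', l')))"
  have dim: "dim_vec (e a) = n" if "a < n" for a
    using e that by (auto simp: orthonormal_basis_def)
  have "X $$ (k, l) = (\<Sum>(b, a)\<in>{..<n} \<times> {..<n}. c (b, a) * ketbra (e b) (e a) $$ (k, l))"
    if kl: "k < n" "l < n" for k l
  proof -
    have "(\<Sum>(b, a)\<in>{..<n} \<times> {..<n}. c (b, a) * ketbra (e b) (e a) $$ (k, l))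
        = (\<Sum>b<n. \<Sum>a<n. e b $ k * (cnj (e a $ l) * c (b, a)))"
      unfolding sum.cartesian_product[symmetric]
      by (intro sum.cong refl) (use kl dim in \<open>simp add: ketbra_def mult_ac\<close>)
    also have "\<dots> = (\<Sum>b<n. e b $ k * (\<Sum>k'<n. cnj (e b $ k') * X $$ (k', l)))"
      by (simp add: c_def orthonormal_basis_expand(2)[OF e kl(2)] flip: sum_distrib_left)
    also have "\<dots> = X $$ (k, l)" by (rule orthonormal_basis_expand(1)[OF e kl(1)])
    finally show ?thesis by simp
  qed
  then show thesis by (rule that)
qed

text \<open>Each generator is a twirled rank-one operator, hence lies in the commutant. Conversely,
  a member \<open>X\<close> equals \<Psi>(X), and expanding \<open>X\<close> in rank-one operators
  turns this into a combination of generators.\<close>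

lemma (in twirled_rep) operator_system_eq_commutant:
  assumes kraus: "kraus_rep n n r A twirling" and e: "orthonormal_basis n e"
  shows "operator_system n n (canonical_kraus n r A e) = commutant n (\<pi> ` carrier G)"
proof -
  let ?R = "canonical_kraus n r A e" and ?C = "commutant n (\<pi> ` carrier G)"
  let ?gens = "{mat_adjoint (?R b) * ?R a | a b. a < n \<and> b < n}"
  interpret V: vectorspace class_ring "module_mat TYPE(complex) n n" by (rule matrix_vs)
  have A: "\<forall>i<r. A i \<in> carrier_mat n n" using kraus by (simp add: kraus_rep_def)
  have ea: "e a \<in> carrier_vec n" if "a < n" for a
    using e that by (simp add: orthonormal_basis_def)
  have K: "ketbra (e b) (e a) \<in> carrier_mat n n" if "a < n" "b < n" for a b
    using ea that by (auto simp: ketbra_def)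
  have prod: "mat_adjoint (?R b) * ?R a = kraus_dual n r A (ketbra (e b) (e a))"
    if "a < n" "b < n" for a b
    using canonical_kraus_product[where e = e, OF A] ea that by simp
  note dual = kraus_dual_carrier trace_kraus_dual[OF kraus]
  have C: "submodule class_ring ?C (module_mat TYPE(complex) n n)"
    using rep_carrier by (intro submodule_commutant) auto
  have gens: "?gens \<subseteq> ?C"
  proof
    fix X assume "X \<in> ?gens"
    then obtain a b where ab: "a < n" "b < n" and X: "X = mat_adjoint (?R b) * ?R a" by blast
    have "X = twirling (ketbra (e b) (e a))"
      unfolding X prod[OF ab] by (rule trace_dual_eq_twirling[OF dual K[OF ab]])
    then show "X \<in> ?C" using twirling_in_commutant[OF K[OF ab]] by simp
  qed
  have gens_carrier: "?gens \<subseteq> carrier (module_mat TYPE(complex) n n)"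
    using gens by (auto simp: commutant_def module_mat_simps)
  have "V.span ?gens = ?C"
  proof
    show "V.span ?gens \<subseteq> ?C" by (rule V.span_is_subset[OF gens C])
    show "?C \<subseteq> V.span ?gens"
    proof
      fix X assume X: "X \<in> ?C"
      then have Xc: "X \<in> carrier_mat n n" by (simp add: commutant_def)
      obtain c where c: "\<And>k l. k < n \<Longrightarrow> l < n \<Longrightarrow>
          X $$ (k, l) = (\<Sum>(b, a)\<in>{..<n} \<times> {..<n}. c (b, a) * ketbra (e b) (e a) $$ (k, l))"
        using ketbra_expand[OF e] by blast
      let ?f = "\<lambda>(b, a). kraus_dual n r A (ketbra (e b) (e a))"
      have "X = kraus_dual n r A X" using trace_dual_fixes_commutant[OF X dual] by simp
      \<comment> \<open>\<Psi> is applied to the expansion of \<open>X\<close> inside each Kraus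
        term; exchanging the two sums collects the values of \<Psi> at the rank-one
        operators.\<close>
      also have "\<dots> = mat n n (\<lambda>(k, l). \<Sum>i\<in>{..<n} \<times> {..<n}. c i * ?f i $$ (k, l))"
      proof (rule eq_matI)
        fix p q assume "p < dim_row (mat n n (\<lambda>(k, l). \<Sum>i\<in>{..<n} \<times> {..<n}. c i * ?f i $$ (k, l)))"
          "q < dim_col (mat n n (\<lambda>(k, l). \<Sum>i\<in>{..<n} \<times> {..<n}. c i * ?f i $$ (k, l)))"
        then have pq: "p < n" "q < n" by auto
        have "kraus_dual n r A X $$ (p, q) = (\<Sum>j<r. \<Sum>i\<in>{..<n} \<times> {..<n}.
            c i * (mat_adjoint (A j) * (case i of (b, a) \<Rightarrow> ketbra (e b) (e a)) * A j) $$ (p, q))"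
          unfolding kraus_dual_def index_mat(1)[OF pq] prod.case
        proof (rule sum.cong[OF refl])
          fix j assume "j \<in> {..<r}"
          then have j: "A j \<in> carrier_mat n n" using A by simp
          then have j': "mat_adjoint (A j) \<in> carrier_mat n n" by (auto simp: mat_adjoint_index)
          show "(mat_adjoint (A j) * X * A j) $$ (p, q) = (\<Sum>i\<in>{..<n} \<times> {..<n}.
              c i * (mat_adjoint (A j) * (case i of (b, a) \<Rightarrow> ketbra (e b) (e a)) * A j) $$ (p, q))"
            by (rule triple_mult_sum_index[OF j' Xc j]) (use K c pq in \<open>auto simp: case_prod_unfold\<close>)
        qed
        also have "\<dots> = (\<Sum>i\<in>{..<n} \<times> {..<n}. c i * ?f i $$ (p, q))"
          by (subst sum.swap) (use pq in \<open>auto simp: kraus_dual_def sum_distrib_left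
              simp del: assoc_mult_mat intro!: sum.cong\<close>)
        finally show "kraus_dual n r A X $$ (p, q)
            = mat n n (\<lambda>(k, l). \<Sum>i\<in>{..<n} \<times> {..<n}. c i * ?f i $$ (k, l)) $$ (p, q)"
          using pq by simp
      qed (auto simp: kraus_dual_def)
      also have "\<dots> \<in> V.span ?gens"
      proof (rule submodule_mat_sum_closed[OF V.span_is_submodule[OF gens_carrier]])
        fix i assume "i \<in> {..<n} \<times> {..<n}"
        then obtain a b where i: "i = (b, a)" "a < n" "b < n" by auto
        have "?f i = mat_adjoint (?R b) * ?R a" using prod[OF i(2,3)] i(1) by simp
        then have "?f i \<in> ?gens" using i(2,3) by blast
        then show "?f i \<in> V.span ?gens" using V.in_own_span[OF gens_carrier] by blast
      qed simp
      finally show "X \<in> V.span ?gens" .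
    qed
  qed
  then show ?thesis by (simp add: operator_system_def)
qed

theorem theorem9:
  fixes G :: "'g monoid" and T :: "'g topology" and \<mu> :: "'g measure"
    and n s r :: nat
    and \<pi> :: "'g \<Rightarrow> complex mat" and \<pi>s :: "nat \<Rightarrow> 'g \<Rightarrow> complex mat"
    and m d :: "nat \<Rightarrow> nat"
    and U :: "complex mat" and A :: "nat \<Rightarrow> complex mat" and e :: "nat \<Rightarrow> complex vec"
  assumes "compact_group G T"
    and "normalized_haar_measure G T \<mu>"
    and "unitary_rep G T n \<pi>"
    and "unitary_mat n U"
    and "\<forall>\<alpha><s. unitary_rep G T (d \<alpha>) (\<pi>s \<alpha>) \<and> irreducible_rep G (d \<alpha>) (\<pi>s \<alpha>)"
    and "\<forall>\<alpha><s. \<forall>\<beta><s. \<alpha> \<noteq> \<beta> \<longrightarrow> \<not> equivalent_reps G (d \<alpha>) (\<pi>s \<alpha>) (d \<beta>) (\<pi>s \<beta>)"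
    and "\<forall>\<alpha><s. m \<alpha> \<ge> 1"
    and "\<forall>g \<in> carrier G. U * \<pi> g * mat_adjoint U =
           diag_block_mat (map (\<lambda>\<alpha>. kronecker (1\<^sub>m (m \<alpha>)) (\<pi>s \<alpha> g)) [0..<s])"
    and "kraus_rep n n r A (twirl G \<mu> n \<pi>)"
    and "orthonormal_basis n e"
  shows "mat_subspace_dim n (operator_system n n (canonical_kraus n r A e)) = (\<Sum>\<alpha><s. (m \<alpha>)\<^sup>2)"
proof -
  interpret twirled_rep G T \<mu> n \<pi> using assms(1-3) by unfold_locales
  interpret multiplicity_blocks s m d .
  have rep: "\<pi>s \<alpha> g \<in> carrier_mat (d \<alpha>) (d \<alpha>)" if "\<alpha> < s" "g \<in> carrier G" for \<alpha> g
    using assms(5) that by (auto simp: unitary_rep_def unitary_mat_def)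
  have decomp: "U * \<pi> g * mat_adjoint U = blocks (\<lambda>\<alpha>. \<pi>s \<alpha> g)" if "g \<in> carrier G" for g
    using assms(8) that by (simp add: blocks_def)
  have U: "U \<in> carrier_mat n n" using assms(4) by (simp add: unitary_mat_def)
  \<comment> \<open>Comparing sizes in the decomposition at the unit of the group gives n as the sum
    of the \<open>m \<alpha> * d \<alpha>\<close>.\<close>
  have "dim_row (U * \<pi> \<one>\<^bsub>G\<^esub> * mat_adjoint U) = n" using U by simp
  moreover have "blocks (\<lambda>\<alpha>. \<pi>s \<alpha> \<one>\<^bsub>G\<^esub>) \<in> carrier_mat total total"
    using rep by (intro blocks_carrier) auto
  ultimately have n: "n = total" using decomp[of "\<one>\<^bsub>G\<^esub>"] by auto
  have "mat_subspace_dim total (commutant total (\<pi> ` carrier G)) = (\<Sum>\<alpha><s. (m \<alpha>)\<^sup>2)"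
    using assms(4-6) rep_carrier rep decomp unfolding n
    by (intro mat_subspace_dim_commutant[where U = U and \<sigma> = \<pi>s]) auto
  then show ?thesis
    using operator_system_eq_commutant[OF assms(9,10)] n by simp
qed

end
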